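(* Let $\theta\in(0,1]$ and let $(Z_n)_{n\ge 0}$ be a power-fractional Galton-Watson process with one ancestor in the iid random environment $\mathbf{e}=(\mathbf e_n)_{n\ge 1}=((A_n,B_n))_{n\ge 1}$ with quenched offspring laws $\mathsf{PF}(\theta,A_n,B_n)$, as described in the context. Suppose the process is critical, so that $R_\infty=R_\infty^{(-1)}=\infty$ a.s. Then, as $n\to\infty$, $$\big(\Pi_nR_n^{(-1)}\big)^{1/\theta}\,\mathbf P^{(n:1)}(Z_n>0)\ \to\ 1\quad\text{a.s.},$$ $$\big(R_n^{(-1)}\big)^{-1/\theta}\,\mathbf E^{(n:1)}(Z_n\,|\,Z_n>0)\ \to\ 1\quad\text{a.s.},$$ and, for almost all realizations of the environment $\mathbf e$, $$\mathbf P^{(n:1)}\Big[\frac{Z_n}{\big(R_n^{(-1)}\big)^{1/\theta}}\in\cdot\,\Big|\,Z_n>0\Big]\ \longrightarrow\ \mathsf{CPF}_+(\theta,1)$$ in distribution (weakly).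
   Context: For $\theta\in(0,1]$ and $a,b>0$ with $a+b\ge 1$, $\mathsf{PF}(\theta,a,b)$ is the probability distribution on $\mathbb{N}_0$ with probability generating function $s\mapsto 1-\big[\frac{a}{(1-s)^{\theta}}+b\big]^{-1/\theta}$, $s\in[0,1)$ (value $1$ at $s=1$). $\mathsf{CPF}_+(\theta,\alpha)$, for $\theta\in(0,1]$ and $\alpha>0$, is the probability distribution on the positive halfline with Laplace transform $u\mapsto 1-\big(\frac{u^{\theta}}{u^{\theta}+\alpha}\big)^{1/\theta}$, $u\ge 0$. Setting: $\mathbf e_n=(A_n,B_n)$, $n\ge 1$, are iid random vectors with $\mathbb{P}(A_n>0,\,B_n>0,\,A_n+B_n\ge 1)=1$. Given $\mathbf e$, $(Z_n)_{n\ge 0}$ is a branching process with $Z_0=1$ in which individuals of generation $n-1$ independently produce offspring with law $\mathsf{PF}(\theta,A_n,B_n)$. For each $n$, $\mathbf P^{(n:1)}$ (with expectation $\mathbf E^{(n:1)}$) denotes the quenched law of $(Z_0,\dots,Z_n)$ under the time-reversed environment $(\mathbf e_n,\dots,\mathbf e_1)$, i.e. given $\mathbf e$, individuals of generation $k-1$ have offspring law $\mathsf{PF}(\theta,A_{n-k+1},B_{n-k+1})$ for $k=1,\dots,n$; thus $Z_n$ has generating function $f_n\circ\cdots\circ f_1$ under $\mathbf P^{(n:1)}$, where $f_k$ is the generating function of $\mathsf{PF}(\theta,A_k,B_k)$. Put $\Pi_0=1$, $\Pi_n=\prod_{k=1}^nA_k$, $R_n^{(-1)}=\sum_{k=1}^n\Pi_k^{-1}B_k$,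 $R_\infty=\sum_{k\ge 1}\Pi_{k-1}B_k$, $R_\infty^{(-1)}=\sum_{k\ge1}\Pi_k^{-1}B_k$. The critical hypothesis means here that $R_\infty=R_\infty^{(-1)}=\infty$ a.s. and $\mathbb{P}(A_1\ne 1)>0$. *)

theory Defs
  imports "HOL-Probability.Probability"
begin

definition pgf :: "nat pmf \<Rightarrow> real \<Rightarrow> real" where
  "pgf p s = measure_pmf.expectation p (\<lambda>k. s ^ k)"

text \<open>
  A law on the natural numbers is determined by its generating function on \<open>[0,1)\<close>, so the
  description below is unambiguous whenever such a law exists; it does for
  \<open>0 < \<theta> \<le> 1\<close>, \<open>a, b > 0\<close> and \<open>a + b \<ge> 1\<close>. Outside this range the value is unspecified.
\<close>

definition PF :: "real \<Rightarrow> real \<Rightarrow> real \<Rightarrow> nat pmf" where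
  "PF \<theta> a b = (THE p. \<forall>s\<in>{0..<1}. pgf p s = 1 - (a / (1 - s) powr \<theta> + b) powr (- 1 / \<theta>))"

text \<open>
  Likewise, a distribution on the positive halfline is determined by its Laplace transform, and
  the one below exists for \<open>0 < \<theta> \<le> 1\<close> and \<open>\<alpha> > 0\<close>.
\<close>

definition CPF_plus :: "real \<Rightarrow> real \<Rightarrow> real measure" where
  "CPF_plus \<theta> \<alpha> = (THE \<mu>. real_distribution \<mu> \<and> measure \<mu> {0<..} = 1 \<and>
     (\<forall>u\<ge>0. (LINT x|\<mu>. exp (- u * x)) = 1 - (u powr \<theta> / (u powr \<theta> + \<alpha>)) powr (1 / \<theta>)))"

text \<open>
  A realization of the environment is a sequence \<open>env\<close> of pairs \<open>(A\<^sub>k, B\<^sub>k)\<close>. Only the indices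
  \<open>k \<ge> 1\<close> matter; \<open>env k\<close> governs the reproduction of generation \<open>k - 1\<close>.
\<close>

definition offspring_law :: "real \<Rightarrow> (nat \<Rightarrow> real \<times> real) \<Rightarrow> nat \<Rightarrow> nat pmf" where
  "offspring_law \<theta> env k = PF \<theta> (fst (env k)) (snd (env k))"

definition total_offspring :: "nat \<Rightarrow> nat pmf \<Rightarrow> nat pmf" where
  "total_offspring z p = map_pmf (\<lambda>\<xi>. \<Sum>i<z. \<xi> i) (Pi_pmf {..<z} 0 (\<lambda>_. p))"

text \<open>
  The quenched law of the path \<open>(Z\<^sub>0, \<dots>, Z\<^sub>n)\<close>, coded as a list \<open>zs\<close> of length \<open>n + 1\<close> with
  \<open>zs ! k = Z\<^sub>k\<close>.
\<close>

primrec quenched_law :: "real \<Rightarrow> (nat \<Rightarrow> real \<times> real) \<Rightarrow> nat \<Rightarrow> nat list pmf" where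
  "quenched_law \<theta> env 0 = return_pmf [1]"
| "quenched_law \<theta> env (Suc n) =
     bind_pmf (quenched_law \<theta> env n) (\<lambda>zs.
       map_pmf (\<lambda>z. zs @ [z]) (total_offspring (zs ! n) (offspring_law \<theta> env (Suc n))))"

text \<open>
  The law \<open>\<^bold>P\<close> with superscript \<open>(n:1)\<close>: the environment \<open>(env n, \<dots>, env 1)\<close> in reversed order, so
  that generation \<open>k - 1\<close> reproduces according to \<open>env (n - k + 1)\<close>, for \<open>1 \<le> k \<le> n\<close>.
\<close>

definition reversed_law :: "real \<Rightarrow> (nat \<Rightarrow> real \<times> real) \<Rightarrow> nat \<Rightarrow> nat list pmf" where
  "reversed_law \<theta> env n = quenched_law \<theta> (\<lambda>k. env (n - k + 1)) n"

definition survival :: "nat \<Rightarrow> nat list set" where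
  "survival n = {zs. zs ! n > 0}"

definition env_Pi :: "(nat \<Rightarrow> real \<times> real) \<Rightarrow> nat \<Rightarrow> real" where
  "env_Pi env n = (\<Prod>k=1..n. fst (env k))"

definition R_inv :: "(nat \<Rightarrow> real \<times> real) \<Rightarrow> nat \<Rightarrow> real" where
  "R_inv env n = (\<Sum>k=1..n. inverse (env_Pi env k) * snd (env k))"

text \<open>The two series run over \<open>k \<ge> 1\<close>, hence the index shift.\<close>

definition R_inf :: "(nat \<Rightarrow> real \<times> real) \<Rightarrow> ennreal" where
  "R_inf env = (\<Sum>k. ennreal (env_Pi env k * snd (env (Suc k))))"

definition R_inv_inf :: "(nat \<Rightarrow> real \<times> real) \<Rightarrow> ennreal" where
  "R_inv_inf env = (\<Sum>k. ennreal (inverse (env_Pi env (Suc k)) * snd (env (Suc k))))"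

end

(*
  Put g(s) = (1 - f(s)) powr (-\<theta>) for a generating function f. For PF(\<theta>, a, b) this is
  a * (1 - s) powr (-\<theta>) + b, so composing generating functions amounts to composing affine maps in
  (1 - s) powr (-\<theta>). In the reversed environment the generating function F of Z_n therefore satisfies
    1 - F(s) = (\<Pi>_n * ((1 - s) powr (-\<theta>) + R_n)) powr (-1/\<theta>),   R_n = R_inv env n.
  The survival probability is 1 - F(0), the mean is F'(1), and the conditional Laplace transform is
  1 - (1 - F(s)) / (1 - F(0)), all explicit; R_n tends to infinity almost surely, and the limits follow.

  PF(\<theta>, a, b) exists because the derivative of its generating function,
    a * (a + b * (1 - s) powr \<theta>) powr (-(1 + 1/\<theta>)),
  expands with nonnegative coefficients: 1 - (1 - s) powr \<theta> does, and so does (1 - x) powr (-c) in x.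
  CPF_+(\<theta>, 1) is obtained as the limit itself: the conditional laws are tight, and every
  subsequential limit has the stated Laplace transform, which determines it (Weierstrass
  approximation in the variable exp(-x)).
*)
theory Submission
  imports Defs
begin

section \<open>Power series with nonnegative coefficients\<close>

text \<open>Absolute monotonicity on [0,1), encoded by nonnegative Taylor coefficients at 0 instead
  of derivatives of all orders. Nothing is required at s = 1, where the functions of interest may
  have infinite slope.\<close>

definition abs_mono :: "(real \<Rightarrow> real) \<Rightarrow> bool" where
  "abs_mono g \<longleftrightarrow> (\<exists>c. (\<forall>k. 0 \<le> c k) \<and> (\<forall>s\<in>{0..<1}. (\<lambda>k::nat. c k * s ^ k) sums g s))"

lemma abs_monoI:
  assumes "\<And>k. 0 \<le> c k" "\<And>s. 0 \<le> s \<Longrightarrow> s < 1 \<Longrightarrow> (\<lambda>k::nat. c k * s ^ k) sums g s"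
  shows "abs_mono g"
  unfolding abs_mono_def by (rule exI[of _ c]) (use assms in auto)

lemma abs_monoE:
  assumes "abs_mono g"
  obtains c where "\<And>k. 0 \<le> c k" "\<And>s. 0 \<le> s \<Longrightarrow> s < 1 \<Longrightarrow> (\<lambda>k::nat. c k * s ^ k) sums g s"
proof -
  from assms obtain c where "\<forall>k. 0 \<le> c k" "\<forall>s\<in>{0..<1}. (\<lambda>k::nat. c k * s ^ k) sums g s"
    unfolding abs_mono_def by blast
  then show thesis by (intro that[of c]) auto
qed

lemma abs_mono_const:
  assumes "0 \<le> a" shows "abs_mono (\<lambda>_. a)"
proof (rule abs_monoI)
  fix s :: real
  show "(\<lambda>k. (if k = 0 then a else 0) * s ^ k) sums a"
    using sums_single[of 0 "\<lambda>k. a * s ^ k"] by (simp add: if_distrib if_distribR cong: if_cong)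
qed (use assms in auto)

lemma abs_mono_mult:
  assumes "abs_mono f" "abs_mono g"
  shows "abs_mono (\<lambda>s. f s * g s)"
proof -
  obtain a where a: "\<And>k. 0 \<le> a k" "\<And>s. 0 \<le> s \<Longrightarrow> s < 1 \<Longrightarrow> (\<lambda>k::nat. a k * s ^ k) sums f s"
    using abs_monoE[OF assms(1)] by metis
  obtain b where b: "\<And>k. 0 \<le> b k" "\<And>s. 0 \<le> s \<Longrightarrow> s < 1 \<Longrightarrow> (\<lambda>k::nat. b k * s ^ k) sums g s"
    using abs_monoE[OF assms(2)] by metis
  show ?thesis
  proof (rule abs_monoI)
    show "0 \<le> (\<Sum>i\<le>k. a i * b (k - i))" for k
      using a(1) b(1) by (intro sum_nonneg mult_nonneg_nonneg)
    fix s :: real assume s: "0 \<le> s" "s < 1"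
    \<comment> \<open>Nonnegative terms make the convergence absolute, as the Cauchy product
      requires.\<close>
    have "summable (\<lambda>k. norm (a k * s ^ k))" "summable (\<lambda>k. norm (b k * s ^ k))"
      using a b s by (auto simp: abs_mult intro!: sums_summable)
    then have "(\<lambda>k. \<Sum>i\<le>k. a i * s ^ i * (b (k - i) * s ^ (k - i))) sums (f s * g s)"
      using Cauchy_product_sums[of "\<lambda>k. a k * s ^ k" "\<lambda>k. b k * s ^ k"]
        sums_unique[OF a(2)[OF s]] sums_unique[OF b(2)[OF s]] by simp
    also have "(\<lambda>k. \<Sum>i\<le>k. a i * s ^ i * (b (k - i) * s ^ (k - i))) = (\<lambda>k. (\<Sum>i\<le>k. a i * b (k - i)) * s ^ k)"
    proof (intro ext, unfold sum_distrib_right, intro sum.cong refl)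
      fix k i :: nat assume "i \<in> {..k}"
      then have "s ^ i * s ^ (k - i) = s ^ k" by (simp flip: power_add)
      then show "a i * s ^ i * (b (k - i) * s ^ (k - i)) = a i * b (k - i) * s ^ k"
        by (metis (no_types, opaque_lifting) mult.assoc mult.left_commute)
    qed
    finally show "(\<lambda>k. (\<Sum>i\<le>k. a i * b (k - i)) * s ^ k) sums (f s * g s)" .
  qed
qed

lemma abs_mono_power: "abs_mono f \<Longrightarrow> abs_mono (\<lambda>s. f s ^ n)"
  by (induction n) (auto intro: abs_mono_const abs_mono_mult)

text \<open>Tonelli: the double series of the nonnegative terms \<open>c n k * s ^ k\<close> may be
  summed in either order. The exchange is carried out in \<open>ennreal\<close>, where every such
  series converges, and is then transferred back to the reals.\<close>

lemma abs_mono_sums: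
  assumes "\<And>n::nat. abs_mono (g n)"
    and G: "\<And>s. 0 \<le> s \<Longrightarrow> s < 1 \<Longrightarrow> (\<lambda>n. g n s) sums G s"
  shows "abs_mono G"
proof -
  have "\<exists>c. \<forall>n. (\<forall>k. 0 \<le> c n k) \<and> (\<forall>s\<in>{0..<1}. (\<lambda>k::nat. c n k * s ^ k) sums g n s)"
    using assms(1) unfolding abs_mono_def by metis
  then obtain c where c': "\<forall>n. (\<forall>k. 0 \<le> c n k) \<and> (\<forall>s\<in>{0..<1}. (\<lambda>k::nat. c n k * s ^ k) sums g n s)"
    by blast
  have c: "0 \<le> c n k" "0 \<le> s \<Longrightarrow> s < 1 \<Longrightarrow> (\<lambda>k. c n k * s ^ k) sums g n s" for n k s
    using c' by auto
  have le: "c n k * s ^ k \<le> g n s" if "0 \<le> s" "s < 1" for n k s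
    using sum_le_suminf[OF sums_summable[OF c(2)[OF that, of n]], of "{k}"] that c(1)
      sums_unique[OF c(2)[OF that, of n]] by simp
  \<comment> \<open>At the fixed point 1/2 each term is dominated by \<open>g n (1/2)\<close>, which
    is summable over n; the constant factor \<open>(1/2) ^ k\<close> is then divided out.\<close>
  have summ: "summable (\<lambda>n. c n k)" for k
  proof -
    have "summable (\<lambda>n. c n k * (1/2) ^ k)"
      using le[of "1/2"] c(1) by (intro summable_comparison_test'[OF sums_summable[OF G[of "1/2"]]]) auto
    from summable_mult2[OF this, of "2 ^ k"] show ?thesis
      by (simp add: mult.assoc flip: power_mult_distrib)
  qed
  show ?thesis
  proof (rule abs_monoI)
    show "0 \<le> (\<Sum>n. c n k)" for k using c(1) summ by (intro suminf_nonneg) auto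
    fix s :: real assume s: "0 \<le> s" "s < 1"
    have gn: "0 \<le> g n s" for n using c(1) s by (intro sums_le[OF _ sums_zero c(2)[OF s]]) auto
    have G0: "0 \<le> G s" using gn by (intro sums_le[OF _ sums_zero G[OF s]]) auto
    have "(\<Sum>k. ennreal ((\<Sum>n. c n k) * s ^ k)) = (\<Sum>k. \<Sum>n. ennreal (c n k * s ^ k))"
    proof (rule suminf_cong)
      fix k
      have "(\<lambda>n. c n k * s ^ k) sums ((\<Sum>n. c n k) * s ^ k)"
        using summ by (intro sums_mult2 summable_sums)
      then have "(\<lambda>n. ennreal (c n k * s ^ k)) sums ennreal ((\<Sum>n. c n k) * s ^ k)"
        using c(1) s summ by (subst sums_ennreal) (auto intro!: suminf_nonneg mult_nonneg_nonneg)
      then show "ennreal ((\<Sum>n. c n k) * s ^ k) = (\<Sum>n. ennreal (c n k * s ^ k))"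
        by (rule sums_unique)
    qed
    also have "\<dots> = (\<Sum>n. \<Sum>k. ennreal (c n k * s ^ k))"
      \<comment> \<open>The sum over k is read as an integral over counting measure and exchanged
        with the sum over n.\<close>
      using nn_integral_suminf[of "\<lambda>n k. ennreal (c n k * s ^ k)" "count_space UNIV"]
      by (simp add: nn_integral_count_space_nat)
    also have "\<dots> = (\<Sum>n. ennreal (g n s))"
      using c s gn by (intro suminf_cong sums_unique[symmetric]) simp
    also have "\<dots> = ennreal (G s)"
      using G[OF s] gn G0 by (intro sums_unique[symmetric]) simp
    finally have eq: "(\<Sum>k. ennreal ((\<Sum>n. c n k) * s ^ k)) = ennreal (G s)" .
    have "(\<lambda>k. ennreal ((\<Sum>n. c n k) * s ^ k)) sums ennreal (G s)"
      unfolding eq[symmetric] by (rule summable_sums) simp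
    then show "(\<lambda>k. (\<Sum>n. c n k) * s ^ k) sums G s"
      using c(1) s summ G0 by (subst (asm) sums_ennreal) (auto intro!: suminf_nonneg mult_nonneg_nonneg)
  qed
qed

text \<open>Termwise integration divides nonnegative coefficients by positive integers. The
  integrated series has the same derivative on (0,1) and the same value at 0 as \<open>f\<close>,
  hence equals \<open>f\<close>.\<close>

lemma abs_mono_antideriv:
  assumes g: "abs_mono g" and f0: "0 \<le> f 0" and cont: "continuous_on {0..<1} f"
    and deriv: "\<And>s. 0 < s \<Longrightarrow> s < 1 \<Longrightarrow> (f has_real_derivative g s) (at s)"
  shows "abs_mono f"
proof -
  obtain c where c: "\<And>k. 0 \<le> c k" "\<And>s. 0 \<le> s \<Longrightarrow> s < 1 \<Longrightarrow> (\<lambda>k::nat. c k * s ^ k) sums g s"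
    using abs_monoE[OF g] by metis
  define p where "p = (\<lambda>k. if k = 0 then f 0 else c (k - 1) / k)"
  have diffs: "diffs p = c" by (auto simp: diffs_def p_def fun_eq_iff)
  have summ: "summable (\<lambda>k. p k * s ^ k)" if s: "0 \<le> s" "s < 1" for s
  proof -
    have "summable (\<lambda>k. p (Suc k) * s ^ Suc k)"
    proof (rule summable_comparison_test')
      show "summable (\<lambda>k. c k * s ^ k)" using c(2)[OF s] by (rule sums_summable)
      fix k :: nat
      have "p (Suc k) \<le> c k" using c(1)[of k] by (simp add: p_def field_simps mult_left_le)
      moreover have "s ^ Suc k \<le> s ^ k" using s by (simp add: mult_left_le_one_le)
      moreover have "0 \<le> p (Suc k)" using c(1)[of k] by (simp add: p_def)
      ultimately have "p (Suc k) * s ^ Suc k \<le> c k * s ^ k"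
        using s c(1)[of k] by (intro mult_mono) (auto simp del: power_Suc)
      with \<open>0 \<le> p (Suc k)\<close> s show "norm (p (Suc k) * s ^ Suc k) \<le> c k * s ^ k"
        by (simp del: power_Suc)
    qed
    then show ?thesis by (subst (asm) summable_Suc_iff)
  qed
  define P where "P = (\<lambda>s. \<Sum>k. p k * s ^ k)"
  have dP: "(P has_real_derivative g s) (at s)" if s: "0 \<le> s" "s < 1" for s
  proof -
    \<comment> \<open>Termwise differentiation at s needs convergence at some point beyond s; the
      midpoint of s and 1 serves.\<close>
    have "(P has_real_derivative (\<Sum>n. diffs p n * s ^ n)) (at s)"
      unfolding P_def using s by (intro termdiffs_strong[of _ "(s + 1) / 2"] summ) auto
    also have "(\<Sum>n. diffs p n * s ^ n) = g s"
      unfolding diffs using sums_unique[OF c(2)[OF s]] by simp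
    finally show ?thesis .
  qed
  have P0: "P 0 = f 0" by (simp add: P_def p_def)
  show ?thesis
  proof (rule abs_monoI[of p])
    show "0 \<le> p k" for k using c(1) f0 by (simp add: p_def)
    fix s :: real assume s: "0 \<le> s" "s < 1"
    have "f s = P s"
    proof (cases "s = 0")
      case False
      have "f s - P s = f 0 - P 0"
      proof (rule DERIV_isconst2[of 0 s "\<lambda>s. f s - P s"])
        show "continuous_on {0..s} (\<lambda>s. f s - P s)"
        proof (intro continuous_on_diff)
          show "continuous_on {0..s} f" by (rule continuous_on_subset[OF cont]) (use s in auto)
          show "continuous_on {0..s} P"
            using s by (intro DERIV_continuous_on[OF has_field_derivative_at_within[OF dP]]) auto
        qed
        show "((\<lambda>s. f s - P s) has_real_derivative 0) (at x)" if "0 < x" "x < s" for x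
          using DERIV_diff[OF deriv[of x] dP[of x]] that s by simp
      qed (use s False in auto)
      then show ?thesis using P0 by simp
    qed (simp add: P0)
    then show "(\<lambda>k. p k * s ^ k) sums f s"
      using summable_sums[OF summ[OF s]] by (simp add: P_def)
  qed
qed

text \<open>Binomial series. For k = m + 1 the Pochhammer symbol of -\<theta> is -\<theta> times the
  product of the factors 1 - \<theta> + i with i < m, which are nonnegative because \<theta> \<le>
  1; the subtraction from 1 removes the constant term and flips the sign of all others.\<close>

lemma abs_mono_one_minus_powr:
  assumes "0 < \<theta>" "\<theta> \<le> 1"
  shows "abs_mono (\<lambda>s. 1 - (1 - s) powr \<theta>)"
proof (rule abs_monoI)
  let ?c = "\<lambda>k. if k = 0 then 0 else - (pochhammer (- \<theta>) k / fact k)"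
  show "0 \<le> ?c k" for k
  proof (cases k)
    case (Suc m)
    then show ?thesis
      using assms prod_nonneg[of "{0..<m}" "\<lambda>i. 1 - \<theta> + real i"]
      by (auto simp: pochhammer_rec pochhammer_prod[of "1 - \<theta>"] intro!: divide_nonneg_nonneg)
  qed simp
  fix s :: real assume s: "0 \<le> s" "s < 1"
  have "(\<lambda>k. (\<theta> gchoose k) * (- s) ^ k) sums (1 + - s) powr \<theta>"
    using s by (intro gen_binomial_real) auto
  moreover have "(\<lambda>k. if k = 0 then 1 else 0 :: real) sums 1"
    using sums_single[of 0 "\<lambda>_. 1::real"] by simp
  ultimately have "(\<lambda>k. (if k = 0 then 1 else 0) - (\<theta> gchoose k) * (- s) ^ k) sums (1 - (1 + - s) powr \<theta>)"
    by (rule sums_diff[rotated])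
  also have "(\<lambda>k. (if k = 0 then 1 else 0) - (\<theta> gchoose k) * (- s) ^ k) = (\<lambda>k. ?c k * s ^ k)"
  proof
    fix k
    have "(- 1) ^ k * (- s) ^ k = s ^ k" by (simp flip: power_mult_distrib)
    then have "(\<theta> gchoose k) * (- s) ^ k = pochhammer (- \<theta>) k / fact k * s ^ k"
      by (simp add: gbinomial_pochhammer)
    then show "(if k = 0 then 1 else 0) - (\<theta> gchoose k) * (- s) ^ k = ?c k * s ^ k"
      by simp
  qed
  finally show "(\<lambda>k. ?c k * s ^ k) sums (1 - (1 - s) powr \<theta>)" by simp
qed

text \<open>The binomial series of (1 - x) powr (-c) has the nonnegative coefficients
  \<open>pochhammer c n / fact n\<close>. Substituting \<open>g\<close> gives a series of multiples
  of powers of \<open>g\<close>, to which the closure properties apply.\<close>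

lemma abs_mono_one_minus_powr_neg:
  assumes g: "abs_mono g" and "0 \<le> c" and lt: "\<And>s. 0 \<le> s \<Longrightarrow> s < 1 \<Longrightarrow> \<bar>g s\<bar> < 1"
  shows "abs_mono (\<lambda>s. (1 - g s) powr (- c))"
proof (rule abs_mono_sums)
  show "abs_mono (\<lambda>s. pochhammer c n / fact n * g s ^ n)" for n
    by (intro abs_mono_mult abs_mono_const abs_mono_power g divide_nonneg_nonneg)
      (use \<open>0 \<le> c\<close> in \<open>auto simp: pochhammer_prod intro!: prod_nonneg\<close>)
  fix s :: real assume s: "0 \<le> s" "s < 1"
  have "(\<lambda>k. (- c gchoose k) * (- g s) ^ k) sums (1 + - g s) powr (- c)"
    using lt[OF s] by (intro gen_binomial_real) auto
  also have "(\<lambda>k. (- c gchoose k) * (- g s) ^ k) = (\<lambda>n. pochhammer c n / fact n * g s ^ n)"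
  proof
    fix k
    have "(- 1) ^ k * (- g s) ^ k = g s ^ k" by (simp flip: power_mult_distrib)
    then show "(- c gchoose k) * (- g s) ^ k = pochhammer c k / fact k * g s ^ k"
      by (simp add: gbinomial_pochhammer)
  qed
  finally show "(\<lambda>n. pochhammer c n / fact n * g s ^ n) sums (1 - g s) powr (- c)" by simp
qed

section \<open>Generating functions of laws on the natural numbers, and existence of the
  power-fractional law\<close>

lemma pgf_sums:
  assumes "0 \<le> s" "s \<le> 1"
  shows "(\<lambda>k. pmf p k * s ^ k) sums pgf p s"
proof -
  have int: "integrable (measure_pmf p) (\<lambda>k. s ^ k)"
    using assms by (intro measure_pmf.integrable_const_bound[where B=1]) (auto simp: power_le_one)
  have "ennreal (pgf p s) = (\<integral>\<^sup>+k. ennreal (s ^ k) \<partial>measure_pmf p)"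
    unfolding pgf_def using assms int by (intro nn_integral_eq_integral[symmetric]) auto
  also have "\<dots> = (\<integral>\<^sup>+k. ennreal (pmf p k * s ^ k) \<partial>count_space UNIV)"
    using assms by (simp add: nn_integral_measure_pmf ennreal_mult')
  also have "\<dots> = (\<Sum>k. ennreal (pmf p k * s ^ k))"
    by (rule nn_integral_count_space_nat)
  finally have eq: "ennreal (pgf p s) = (\<Sum>k. ennreal (pmf p k * s ^ k))" .
  have "(\<lambda>k. ennreal (pmf p k * s ^ k)) sums ennreal (pgf p s)"
    unfolding eq by (rule summable_sums) simp
  then show ?thesis
    using assms by (subst (asm) sums_ennreal) (auto simp: pgf_def intro!: integral_nonneg_AE)
qed

text \<open>The coefficients serve as the weights of the law. Their partial sums are at most the
  left limit 1, and \<open>f s\<close> is at most their total, which is therefore exactly 1.\<close>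

lemma abs_mono_imp_pgf:
  assumes f: "abs_mono f" and lim: "(f \<longlongrightarrow> 1) (at_left 1)"
  shows "\<exists>p. \<forall>s\<in>{0..<1}. pgf p s = f s"
proof -
  obtain c where c: "\<And>k. 0 \<le> c k" "\<And>s. 0 \<le> s \<Longrightarrow> s < 1 \<Longrightarrow> (\<lambda>k::nat. c k * s ^ k) sums f s"
    using abs_monoE[OF f] by metis
  have ev: "\<forall>\<^sub>F s in at_left (1::real). 0 \<le> s \<and> s < 1"
    by (auto simp: eventually_at_left[of 0] intro!: exI[of _ 0])
  have part: "(\<Sum>k<n. c k) \<le> 1" for n
  proof (rule tendsto_le[OF _ lim])
    show "((\<lambda>s. \<Sum>k<n. c k * s ^ k) \<longlongrightarrow> (\<Sum>k<n. c k)) (at_left 1)"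
      by (auto intro!: tendsto_eq_intros)
    show "\<forall>\<^sub>F s in at_left 1. (\<Sum>k<n. c k * s ^ k) \<le> f s"
      using ev
    proof eventually_elim
      case (elim s)
      then show ?case
        using sum_le_suminf[OF sums_summable[OF c(2)[of s]], of "{..<n}"] c(1) sums_unique[OF c(2)[of s]] by simp
    qed
  qed simp
  have summ: "summable c"
    by (rule summableI_nonneg_bounded[of c 1]) (use c(1) part in auto)
  have "suminf c \<le> 1" using part summ by (intro suminf_le_const) auto
  moreover have "1 \<le> suminf c"
  proof (rule tendsto_upperbound[OF lim])
    show "\<forall>\<^sub>F s in at_left 1. f s \<le> suminf c"
      using ev
    proof eventually_elim
      case (elim s)
      then show ?case
        using c(1) by (intro sums_le[OF _ c(2)[of s] summable_sums[OF summ]]) (auto simp: mult_left_le power_le_one)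
    qed
  qed simp
  ultimately have "c sums 1" using summ by (auto simp: sums_iff)
  then have "(\<lambda>k. ennreal (c k)) sums ennreal 1" using c(1) by (subst sums_ennreal) auto
  then have nn: "(\<integral>\<^sup>+k. ennreal (c k) \<partial>count_space UNIV) = 1"
    by (simp add: nn_integral_count_space_nat sums_iff)
  have pmf: "pmf (embed_pmf c) k = c k" for k by (rule pmf_embed_pmf[OF c(1) nn])
  show ?thesis
  proof (intro exI[of _ "embed_pmf c"] ballI)
    fix s :: real assume "s \<in> {0..<1}"
    then have s: "0 \<le> s" "s < 1" by auto
    show "pgf (embed_pmf c) s = f s"
      using pgf_sums[of s "embed_pmf c"] c(2)[OF s] s unfolding pmf by (auto intro: sums_unique2)
  qed
qed

lemma PF_pgf_ex:
  assumes th: "0 < \<theta>" "\<theta> \<le> 1" and ab: "0 < a" "0 < b" "1 \<le> a + b"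
  shows "\<exists>p. \<forall>s\<in>{0..<1}. pgf p s = 1 - (a / (1 - s) powr \<theta> + b) powr (- 1 / \<theta>)"
proof -
  \<comment> \<open>Pulling (1 - s) powr (-\<theta>) out of the bracket turns the required formula
    into \<open>f\<close>; this form is regular at s = 1, since \<open>?w\<close> tends to a > 0
    there.\<close>
  let ?w = "\<lambda>s::real. a + b * (1 - s) powr \<theta>"
  define f where "f = (\<lambda>s::real. 1 - (1 - s) * ?w s powr (- 1 / \<theta>))"
  \<comment> \<open>Chosen so that \<open>?w s = (a + b) * (1 - ?g s)\<close>. As q < 1,
    \<open>?g\<close> stays in [0,1), within reach of the binomial series.\<close>
  define q where "q = b / (a + b)"
  have q: "0 < q" "q < 1" using ab by (auto simp: q_def)
  let ?g = "\<lambda>s::real. q * (1 - (1 - s) powr \<theta>)"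
  have w_pos: "0 < ?w s" for s using ab by (intro add_pos_nonneg) auto
  have deriv: "(f has_real_derivative a * ?w s powr (- (1 / \<theta> + 1))) (at s)" if "s < 1" for s
  proof -
    have e: "(1 - s) powr (\<theta> - 1) * (1 - s) = (1 - s) powr \<theta>"
      using that by (simp add: powr_diff)
    have e2: "?w s powr (- 1 / \<theta>) = ?w s * ?w s powr (- (1 / \<theta> + 1))"
    proof -
      have "?w s powr (- 1 / \<theta>) = ?w s powr (1 + - (1 / \<theta> + 1))" by simp
      also have "\<dots> = ?w s * ?w s powr (- (1 / \<theta> + 1))"
        unfolding powr_add using w_pos[of s] by simp
      finally show ?thesis .
    qed
    have e3: "?w s powr (- 1 / \<theta> - 1) = ?w s powr (- (1 / \<theta> + 1))"
      by (rule arg_cong[where f="\<lambda>x. _ powr x"]) simp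
    have "(f has_real_derivative ?w s powr (- 1 / \<theta>) - (1 - s) * ((1 / \<theta>) * ?w s powr (- 1 / \<theta> - 1) *
       (b * (\<theta> * (1 - s) powr (\<theta> - 1))))) (at s)"
      unfolding f_def using that w_pos[of s] th by (auto intro!: derivative_eq_intros)
    \<comment> \<open>Once the common power is factored out, what remains is
      \<open>?w s - b * (1 - s) powr \<theta> = a\<close>: the fractional terms cancel.\<close>
    also have "?w s powr (- 1 / \<theta>) - (1 - s) * ((1 / \<theta>) * ?w s powr (- 1 / \<theta> - 1) *
       (b * (\<theta> * (1 - s) powr (\<theta> - 1)))) = ?w s powr (- (1 / \<theta> + 1)) * (?w s - b * ((1 - s) powr (\<theta> - 1) * (1 - s)))"
      unfolding e2 e3 using th by (simp add: field_simps)
    also have "\<dots> = a * ?w s powr (- (1 / \<theta> + 1))" unfolding e by simp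
    finally show ?thesis .
  qed
  have "abs_mono (\<lambda>s. a * ((a + b) powr (- (1 / \<theta> + 1)) * (1 - ?g s) powr (- (1 / \<theta> + 1))))"
  proof (intro abs_mono_mult abs_mono_const abs_mono_one_minus_powr_neg abs_mono_one_minus_powr th)
    fix s :: real assume s: "0 \<le> s" "s < 1"
    then have "(1 - s) powr \<theta> \<le> 1" using th by (intro powr_le1) auto
    moreover have "0 \<le> (1 - s) powr \<theta>" by simp
    ultimately show "\<bar>?g s\<bar> < 1" using q
      by (smt (verit, ccfv_SIG) mult_left_le mult_nonneg_nonneg)
  qed (use ab q th in auto)
  also have "(\<lambda>s. a * ((a + b) powr (- (1 / \<theta> + 1)) * (1 - ?g s) powr (- (1 / \<theta> + 1)))) =
      (\<lambda>s. a * ?w s powr (- (1 / \<theta> + 1)))"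
  proof
    fix s
    have "(a + b) * (1 - ?g s) = ?w s" using ab by (simp add: q_def field_simps)
    moreover from this have "0 < 1 - ?g s"
      using w_pos[of s] ab by (metis add_pos_pos zero_less_mult_pos)
    ultimately show "a * ((a + b) powr (- (1 / \<theta> + 1)) * (1 - ?g s) powr (- (1 / \<theta> + 1))) = a * ?w s powr (- (1 / \<theta> + 1))"
      using ab by (metis powr_mult)
  qed
  finally have D: "abs_mono (\<lambda>s. a * ?w s powr (- (1 / \<theta> + 1)))" .
  have "abs_mono f"
  proof (rule abs_mono_antideriv[OF D])
    \<comment> \<open>The value is \<open>1 - (a + b) powr (- 1 / \<theta>)\<close>, nonnegative
      because a + b \<ge> 1.\<close>
    show "0 \<le> f 0"
      using ab th by (simp add: f_def powr_minus_divide) (auto simp: field_simps intro!: ge_one_powr_ge_zero)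
    show "continuous_on {0..<1} f"
      by (intro DERIV_continuous_on[OF has_field_derivative_at_within[OF deriv]]) auto
  qed (use deriv in auto)
  moreover have "(f \<longlongrightarrow> 1) (at_left 1)"
  proof -
    have "((\<lambda>s::real. (1 - s) powr \<theta>) \<longlongrightarrow> 0 powr \<theta>) (at_left 1)"
      using th by (intro tendsto_powr2) (auto intro!: tendsto_eq_intros eventually_at_leftI[of 0])
    then have "(?w \<longlongrightarrow> a + b * 0) (at_left 1)"
      by (intro tendsto_add tendsto_mult tendsto_const) simp
    then have "((\<lambda>s. ?w s powr (- 1 / \<theta>)) \<longlongrightarrow> (a + b * 0) powr (- 1 / \<theta>)) (at_left 1)"
      using ab by (intro tendsto_powr tendsto_const) auto
    moreover have "((\<lambda>s::real. 1 - s) \<longlongrightarrow> 0) (at_left 1)"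
      by (auto intro!: tendsto_eq_intros)
    ultimately have "(f \<longlongrightarrow> 1 - 0 * (a + b * 0) powr (- 1 / \<theta>)) (at_left 1)"
      unfolding f_def by (intro tendsto_diff tendsto_mult tendsto_const)
    then show ?thesis by simp
  qed
  ultimately obtain p where p: "\<forall>s\<in>{0..<1}. pgf p s = f s"
    using abs_mono_imp_pgf by blast
  show ?thesis
  proof (intro exI[of _ p] ballI)
    fix s :: real assume "s \<in> {0..<1}"
    then have s: "0 \<le> s" "s < 1" by auto
    have "(a / (1 - s) powr \<theta> + b) = (1 - s) powr (- \<theta>) * ?w s"
      using s by (simp add: powr_minus_divide field_simps)
    also have "\<dots> powr (- 1 / \<theta>) = (1 - s) * ?w s powr (- 1 / \<theta>)"
      using s th w_pos[of s] by (subst powr_mult) (auto simp: powr_powr)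
    finally show "pgf p s = 1 - (a / (1 - s) powr \<theta> + b) powr (- 1 / \<theta>)"
      using p s by (simp add: f_def)
  qed
qed

section \<open>Laplace transforms of laws on the positive halfline\<close>

lemma laplace_integrable:
  assumes "prob_space \<mu>" "sets \<mu> = sets borel" "AE x in \<mu>. 0 \<le> x" "0 \<le> (u::real)"
  shows "integrable \<mu> (\<lambda>x::real. exp (- u * x))"
proof -
  interpret prob_space \<mu> by fact
  show ?thesis
    using assms(3) by (intro integrable_const_bound[where B=1])
     (auto simp: assms(2) measurable_cong_sets[OF assms(2) refl] assms(4) intro!: mult_nonneg_nonneg elim!: AE_mp)
qed

text \<open>In the variable y = exp(-x), which lies in [0,1] almost everywhere, the transforms at
  integer arguments are the moments of y. So polynomials in y have equal integrals, and uniform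
  approximation carries this over to continuous \<open>g\<close>.\<close>

lemma laplace_eq_imp_integral_eq:
  fixes g :: "real \<Rightarrow> real"
  assumes \<mu>: "real_distribution \<mu>" "AE x in \<mu>. 0 \<le> x"
    and \<nu>: "real_distribution \<nu>" "AE x in \<nu>. 0 \<le> x"
    and eq: "\<And>u. 0 \<le> u \<Longrightarrow> (LINT x|\<mu>. exp (- u * x)) = (LINT x|\<nu>. exp (- u * x))"
    and g: "continuous_on UNIV g"
  shows "(LINT x|\<mu>. g (exp (- x))) = (LINT x|\<nu>. g (exp (- x)))"
proof (rule ccontr)
  assume neq: "(LINT x|\<mu>. g (exp (- x))) \<noteq> (LINT x|\<nu>. g (exp (- x)))"
  \<comment> \<open>A third of the gap: the two approximation errors, at most e each, cannot bridge
    3 e.\<close>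
  define e where "e = \<bar>(LINT x|\<mu>. g (exp (- x))) - (LINT x|\<nu>. g (exp (- x)))\<bar> / 3"
  have e: "0 < e" using neq by (simp add: e_def)
  obtain h where h: "real_polynomial_function h" and gh: "\<And>x. x \<in> {0..1} \<Longrightarrow> \<bar>g x - h x\<bar> < e"
    using Stone_Weierstrass_real_polynomial_function[of "{0..1::real}" g e] e
      continuous_on_subset[OF g] by auto
  obtain c n where hc: "h = (\<lambda>x. \<Sum>i\<le>n. c i * x ^ i)"
    using h real_polynomial_function_iff_sum by blast
  have g_meas: "g \<in> borel_measurable borel" using g by (rule borel_measurable_continuous_onI)
  obtain B where B: "\<forall>x\<in>{0..1}. norm (g x) \<le> B"
    using compact_imp_bounded[OF compact_continuous_image[OF continuous_on_subset[OF g], of "{0..1}"]]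
    unfolding bounded_iff by auto
  have ex: "exp (- x) ^ i = exp (- real i * x)" for x :: real and i
    by (simp add: exp_of_nat_mult[symmetric])
  have poly: "(LINT x|\<rho>. h (exp (- x))) = (\<Sum>i\<le>n. c i * (LINT x|\<rho>. exp (- real i * x)))"
    and diff: "\<bar>(LINT x|\<rho>. g (exp (- x))) - (LINT x|\<rho>. h (exp (- x)))\<bar> \<le> e"
    if \<rho>: "real_distribution \<rho>" "AE x in \<rho>. 0 \<le> x" for \<rho>
  proof -
    interpret real_distribution \<rho> by fact
    have int: "integrable \<rho> (\<lambda>x. exp (- real i * x))" for i
      by (intro laplace_integrable \<rho>) (auto simp: prob_space_axioms)
    show "(LINT x|\<rho>. h (exp (- x))) = (\<Sum>i\<le>n. c i * (LINT x|\<rho>. exp (- real i * x)))"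
      unfolding hc ex using int by (subst Bochner_Integration.integral_sum) auto
    have int_h: "integrable \<rho> (\<lambda>x. h (exp (- x)))"
      unfolding hc ex using int by (intro Bochner_Integration.integrable_sum) auto
    have int_g: "integrable \<rho> (\<lambda>x. g (exp (- x)))"
    proof (rule integrable_const_bound)
      show "AE x in \<rho>. norm (g (exp (- x))) \<le> B"
        using \<rho>(2) by eventually_elim (use B in auto)
      show "(\<lambda>x. g (exp (- x))) \<in> borel_measurable \<rho>"
        using g_meas by measurable
    qed
    have "\<bar>LINT x|\<rho>. g (exp (- x)) - h (exp (- x))\<bar> \<le> (LINT x|\<rho>. \<bar>g (exp (- x)) - h (exp (- x))\<bar>)"
      using integral_norm_bound[of \<rho> "\<lambda>x. g (exp (- x)) - h (exp (- x))"] by simp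
    also have "\<dots> \<le> e"
    proof (rule integral_le_const)
      show "integrable \<rho> (\<lambda>x. \<bar>g (exp (- x)) - h (exp (- x))\<bar>)"
        using int_g int_h by auto
      show "AE x in \<rho>. \<bar>g (exp (- x)) - h (exp (- x))\<bar> \<le> e"
        using \<rho>(2) by eventually_elim (use gh in \<open>force intro: less_imp_le\<close>)
    qed
    finally show "\<bar>(LINT x|\<rho>. g (exp (- x))) - (LINT x|\<rho>. h (exp (- x)))\<bar> \<le> e"
      using int_g int_h by simp
  qed
  have "(LINT x|\<mu>. h (exp (- x))) = (LINT x|\<nu>. h (exp (- x)))"
    unfolding poly[OF \<mu>] poly[OF \<nu>] using eq by simp
  with diff[OF \<mu>] diff[OF \<nu>] e show False unfolding e_def by argo
qed


text \<open>For b > a a continuous ramp in exp(-x), equal to 1 for x \<le> a and to 0 for x \<ge> b,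
  lies between the indicators of the two halflines. Letting b decrease to a uses right continuity of
  the distribution function. Exchanging the two laws gives the reverse inequality.\<close>

lemma cdf_le_of_laplace_eq:
  assumes \<mu>: "real_distribution \<mu>" "AE x in \<mu>. 0 \<le> x"
    and \<nu>: "real_distribution \<nu>" "AE x in \<nu>. 0 \<le> x"
    and eq: "\<And>u. 0 \<le> u \<Longrightarrow> (LINT x|\<mu>. exp (- u * x)) = (LINT x|\<nu>. exp (- u * x))"
  shows "cdf \<mu> a \<le> cdf \<nu> a"
proof -
  interpret mu: real_distribution \<mu> by fact
  interpret nu: real_distribution \<nu> by fact
  have le: "cdf \<mu> a \<le> cdf \<nu> b" if "a < b" for b
  proof -
    define y0 y1 where "y0 = exp (- b)" and "y1 = exp (- a)"
    have y: "y0 < y1" using that by (simp add: y0_def y1_def)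
    define g where "g = (\<lambda>y. max 0 (min 1 ((y - y0) / (y1 - y0))))"
    have g: "continuous_on UNIV g" unfolding g_def using y by (intro continuous_intros) auto
    have g_meas[measurable]: "g \<in> borel_measurable borel" using g by (rule borel_measurable_continuous_onI)
    have g01: "0 \<le> g x" "g x \<le> 1" for x by (auto simp: g_def)
    have int: "integrable \<rho> (\<lambda>x. g (exp (- x)))" if "real_distribution \<rho>" for \<rho>
    proof -
      interpret real_distribution \<rho> by fact
      show ?thesis by (intro integrable_const_bound[where B=1]) (use g01 in auto)
    qed
    have low: "indicator {..a} x \<le> g (exp (- x))" for x
    proof (cases "x \<le> a")
      case True
      then have "1 \<le> (exp (- x) - y0) / (y1 - y0)" using y by (simp add: y1_def)
      then show ?thesis by (simp add: g_def True)
    qed (simp add: g01)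
    have up: "g (exp (- x)) \<le> indicator {..b} x" for x
    proof (cases "x \<le> b")
      case False
      then have "(exp (- x) - y0) / (y1 - y0) \<le> 0"
        using y by (intro divide_nonpos_pos) (auto simp: y0_def)
      then show ?thesis by (simp add: g_def False)
    qed (simp add: g01)
    have "cdf \<mu> a = (LINT x|\<mu>. indicator {..a} x)" by (simp add: cdf_def)
    also have "\<dots> \<le> (LINT x|\<mu>. g (exp (- x)))"
      using low by (intro integral_mono int \<mu>) (auto simp: integrable_indicator_iff mu.emeasure_eq_measure)
    also have "\<dots> = (LINT x|\<nu>. g (exp (- x)))"
      by (rule laplace_eq_imp_integral_eq[OF \<mu> \<nu> eq g])
    also have "\<dots> \<le> (LINT x|\<nu>. indicator {..b} x)"
      using up by (intro integral_mono int \<nu>) (auto simp: integrable_indicator_iff nu.emeasure_eq_measure)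
    also have "\<dots> = cdf \<nu> b" by (simp add: cdf_def)
    finally show ?thesis .
  qed
  show ?thesis
  proof (rule tendsto_lowerbound)
    show "(cdf \<nu> \<longlongrightarrow> cdf \<nu> a) (at_right a)"
      using nu.cdf_is_right_cont by (simp add: continuous_within)
    show "\<forall>\<^sub>F b in at_right a. cdf \<mu> a \<le> cdf \<nu> b"
      using le by (auto simp: eventually_at_filter)
  qed simp
qed

lemma laplace_eq_imp_eq:
  assumes \<mu>: "real_distribution \<mu>" "AE x in \<mu>. 0 \<le> x"
    and \<nu>: "real_distribution \<nu>" "AE x in \<nu>. 0 \<le> x"
    and eq: "\<And>u. 0 \<le> u \<Longrightarrow> (LINT x|\<mu>. exp (- u * x)) = (LINT x|\<nu>. exp (- u * x))"
  shows "\<mu> = \<nu>"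
proof (rule cdf_unique)
  show "cdf \<mu> = cdf \<nu>"
    using cdf_le_of_laplace_eq[OF \<mu> \<nu> eq] cdf_le_of_laplace_eq[OF \<nu> \<mu> eq[symmetric]]
    by (auto intro!: ext antisym)
qed fact+

section \<open>Tightness and the continuity theorem for Laplace transforms\<close>

lemma laplace_tail_bound:
  assumes \<mu>: "real_distribution \<mu>" "AE x in \<mu>. 0 \<le> x" and u: "0 < u" and K: "1 / u \<le> K"
  shows "(1 - cdf \<mu> K) * (1 - exp (- 1)) \<le> 1 - (LINT x|\<mu>. exp (- u * x))"
proof -
  interpret real_distribution \<mu> by fact
  have int: "integrable \<mu> (\<lambda>x. exp (- u * x))"
    using u by (intro laplace_integrable \<mu>) (auto simp: prob_space_axioms)
  have "1 - cdf \<mu> K = measure \<mu> {K<..}"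
    using prob_compl[of "{..K}"] by (simp add: cdf_def Compl_eq_Diff_UNIV[symmetric])
  then have "(1 - cdf \<mu> K) * (1 - exp (- 1)) = (LINT x|\<mu>. indicator {K<..} x * (1 - exp (- 1)))"
    by simp
  \<comment> \<open>Markov-type bound: x > K \<ge> 1/u forces u x \<ge> 1, so the integrand on the
    right is at least 1 - exp(-1) there, and it is nonnegative elsewhere.\<close>
  also have "\<dots> \<le> (LINT x|\<mu>. 1 - exp (- u * x))"
  proof (rule integral_mono_AE)
    show "AE x in \<mu>. indicator {K<..} x * (1 - exp (- 1)) \<le> 1 - exp (- u * x)"
      using \<mu>(2)
    proof eventually_elim
      case (elim x)
      have "1 / u < x \<Longrightarrow> 1 \<le> u * x" using u by (simp add: field_simps)
      then have "1 \<le> u * x" if "K < x" using that K by linarith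
      with elim u show ?case by (auto split: split_indicator)
    qed
  qed (use int in \<open>auto simp: integrable_indicator_iff emeasure_eq_measure\<close>)
  also have "\<dots> = 1 - (LINT x|\<mu>. exp (- u * x))"
    using int prob_space by simp
  finally show ?thesis .
qed

text \<open>Since \<open>L\<close> tends to 1 at 0, some u > 0 makes the tail bound small for all
  large n; the finitely many remaining laws are covered by enlarging K.\<close>

lemma tight_of_laplace:
  assumes \<mu>: "\<And>n. real_distribution (\<mu> n)" "\<And>n. AE x in \<mu> n. 0 \<le> x"
    and lim: "\<And>u. 0 < u \<Longrightarrow> (\<lambda>n. LINT x|\<mu> n. exp (- u * x)) \<longlonglongrightarrow> L u"
    and L: "(L \<longlongrightarrow> 1) (at_right 0)"
  shows "tight \<mu>"
  unfolding tight_def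
proof (intro conjI allI impI \<mu>(1))
  fix \<epsilon> :: real assume \<epsilon>: "0 < \<epsilon>"
  \<comment> \<open>Scaled by the constant of the tail bound, so that a transform above 1 - d means
    a tail below \<epsilon>.\<close>
  define d where "d = \<epsilon> * (1 - exp (- 1))"
  have d: "0 < d" using \<epsilon> by (simp add: d_def)
  have "\<forall>\<^sub>F u in at_right 0. 1 - d < L u" using d by (intro order_tendstoD(1)[OF L]) simp
  then obtain u where u: "0 < u" "1 - d < L u"
    using eventually_happens[OF eventually_conj[OF eventually_at_right_less[of "0::real"]]] by force
  obtain N where N: "\<And>n. n \<ge> N \<Longrightarrow> 1 - d < (LINT x|\<mu> n. exp (- u * x))"
    using order_tendstoD(1)[OF lim[OF u(1)] u(2)] unfolding eventually_sequentially by auto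
  have "\<exists>K. 1 - \<epsilon> < cdf (\<mu> n) K" for n
  proof -
    interpret real_distribution "\<mu> n" by (rule \<mu>)
    have "\<forall>\<^sub>F K in at_top. 1 - \<epsilon> < cdf (\<mu> n) K"
      using \<epsilon> by (intro order_tendstoD(1)[OF cdf_lim_at_top_prob]) simp
    then show ?thesis by (metis eventually_happens trivial_limit_at_top_linorder)
  qed
  then obtain k where k: "\<And>n. 1 - \<epsilon> < cdf (\<mu> n) (k n)" by metis
  define K where "K = 1 / u + (\<Sum>n<N. \<bar>k n\<bar>)"
  have K: "1 / u \<le> K" by (simp add: K_def sum_nonneg)
  have K_pos: "0 < K" using u(1) K by (metis divide_pos_pos less_le_trans zero_less_one)
  have "1 - \<epsilon> < measure (\<mu> n) {-1<..K}" for n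
  proof -
    interpret real_distribution "\<mu> n" by (rule \<mu>)
    have "1 - \<epsilon> < cdf (\<mu> n) K"
    proof (cases "n < N")
      case True
      then have "\<bar>k n\<bar> \<le> (\<Sum>n<N. \<bar>k n\<bar>)" by (intro member_le_sum) auto
      then have "k n \<le> K" using u(1) by (simp add: K_def) (smt (verit) divide_nonneg_pos)
      then show ?thesis using k[of n] cdf_nondecreasing[of "k n" K] by linarith
    next
      case False
      then have "(1 - cdf (\<mu> n) K) * (1 - exp (- 1)) < d"
        using laplace_tail_bound[OF \<mu> u(1) K, of n] N[of n] by linarith
      then have "1 - cdf (\<mu> n) K < \<epsilon>" unfolding d_def by (rule mult_right_less_imp_less) simp
      then show ?thesis by simp
    qed
    \<comment> \<open>The left end -1 instead of 0 keeps a possible atom at 0 inside the half-open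
      interval.\<close>
    also have "cdf (\<mu> n) K = measure (\<mu> n) {-1<..K}"
      unfolding cdf_def by (intro finite_measure_eq_AE) (use \<mu>(2)[of n] in auto)
    finally show ?thesis .
  qed
  then show "\<exists>a b. a < b \<and> (\<forall>n. 1 - \<epsilon> < measure (\<mu> n) {a<..b})"
    using K_pos by (intro exI[of _ "-1"] exI[of _ K]) auto
qed

text \<open>Weak convergence is tested on bounded continuous functions over the whole line.
  Nonnegativity of the limit is therefore read off from the truncated negative part, and exp(-u x),
  unbounded for negative x if u > 0, is replaced by \<open>exp (- u * max 0 x)\<close>, which agrees
  with it almost everywhere.\<close>

lemma weak_conv_laplace:
  assumes \<mu>: "\<And>n. real_distribution (\<mu> n)" "\<And>n. AE x in \<mu> n. 0 \<le> x"
    and \<nu>: "real_distribution \<nu>" and conv: "weak_conv_m \<mu> \<nu>"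
  shows "AE x in \<nu>. 0 \<le> x"
    and "0 \<le> u \<Longrightarrow> (\<lambda>n. LINT x|\<mu> n. exp (- u * x)) \<longlonglongrightarrow> (LINT x|\<nu>. exp (- u * x))"
proof -
  interpret \<nu>: real_distribution \<nu> by fact
  let ?h = "\<lambda>x::real. min 1 (max 0 (- x))"
  have "(\<lambda>n. LINT x|\<mu> n. ?h x) \<longlonglongrightarrow> (LINT x|\<nu>. ?h x)"
    by (rule weak_conv_imp_integral_bdd_continuous_conv[OF \<mu>(1) \<nu> conv, where B=1])
      (auto intro!: continuous_intros)
  moreover have "(LINT x|\<mu> n. ?h x) = 0" for n
    using \<mu>(2)[of n] by (intro integral_eq_zero_AE) auto
  ultimately have "(LINT x|\<nu>. ?h x) = 0"
    using LIMSEQ_unique[OF _ tendsto_const] by simp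
  moreover have "integrable \<nu> ?h"
    by (intro \<nu>.integrable_const_bound[where B=1]) auto
  ultimately have "AE x in \<nu>. ?h x = 0"
    by (subst (asm) integral_nonneg_eq_0_iff_AE) auto
  then show nn: "AE x in \<nu>. 0 \<le> x"
    by eventually_elim (auto simp: min_def max_def split: if_splits)
  assume u: "0 \<le> u"
  have "(\<lambda>n. LINT x|\<mu> n. exp (- u * max 0 x)) \<longlonglongrightarrow> (LINT x|\<nu>. exp (- u * max 0 x))"
    using u by (intro weak_conv_imp_integral_bdd_continuous_conv[OF \<mu>(1) \<nu> conv, where B=1])
      (auto intro!: continuous_intros mult_nonneg_nonneg)
  moreover have "(LINT x|\<rho>. exp (- u * max 0 x)) = (LINT x|\<rho>. exp (- u * x))"
    if "real_distribution \<rho>" "AE x in \<rho>. 0 \<le> x" for \<rho>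
  proof -
    interpret real_distribution \<rho> by fact
    show ?thesis using that(2) by (intro integral_cong_AE) (auto simp: max_def elim: AE_mp)
  qed
  ultimately show "(\<lambda>n. LINT x|\<mu> n. exp (- u * x)) \<longlonglongrightarrow> (LINT x|\<nu>. exp (- u * x))"
    using \<mu> \<nu> nn by simp
qed

text \<open>\<open>L\<close> is not assumed to be a Laplace transform: the law \<open>\<nu>\<close>
  is obtained as a subsequential limit, its behaviour at 0 preventing loss of mass. Every other
  subsequential limit has the same transform, so the whole sequence converges.\<close>

theorem laplace_continuity:
  assumes \<mu>: "\<And>n. real_distribution (\<mu> n)" "\<And>n. AE x in \<mu> n. 0 \<le> x"
    and lim: "\<And>u. 0 \<le> u \<Longrightarrow> (\<lambda>n. LINT x|\<mu> n. exp (- u * x)) \<longlonglongrightarrow> L u"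
    and L: "(L \<longlongrightarrow> 1) (at_right 0)"
  obtains \<nu> where "real_distribution \<nu>" "AE x in \<nu>. 0 \<le> x"
    "\<forall>u\<ge>0. (LINT x|\<nu>. exp (- u * x)) = L u" "weak_conv_m \<mu> \<nu>"
proof -
  have tight: "tight \<mu>" by (rule tight_of_laplace[OF \<mu> lim L]) auto
  have limit: "(AE x in \<nu>. 0 \<le> x) \<and> (\<forall>u\<ge>0. (LINT x|\<nu>. exp (- u * x)) = L u)"
    if s: "strict_mono s" and \<nu>: "real_distribution \<nu>" "weak_conv_m (\<mu> \<circ> s) \<nu>" for s \<nu>
  proof -
    have wc: "real_distribution ((\<mu> \<circ> s) n)" "AE x in (\<mu> \<circ> s) n. 0 \<le> x" for n
      unfolding comp_apply by (rule \<mu>)+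
    have "(LINT x|\<nu>. exp (- u * x)) = L u" if u: "0 \<le> u" for u
      using weak_conv_laplace(2)[OF wc \<nu> u] LIMSEQ_subseq_LIMSEQ[OF lim[OF u] s]
      by (intro LIMSEQ_unique) (auto simp: comp_def)
    with weak_conv_laplace(1)[OF wc \<nu>] show ?thesis by auto
  qed
  obtain r \<nu> where r: "strict_mono r" "real_distribution \<nu>" "weak_conv_m (\<mu> \<circ> id \<circ> r) \<nu>"
    using tight_imp_convergent_subsubsequence[OF tight strict_mono_id] by blast
  then have \<nu>: "real_distribution \<nu>" "AE x in \<nu>. 0 \<le> x" "\<forall>u\<ge>0. (LINT x|\<nu>. exp (- u * x)) = L u"
    using limit[of r \<nu>] by auto
  have "weak_conv_m \<mu> \<nu>"
  proof (rule tight_subseq_weak_converge[OF \<mu>(1) \<nu>(1) tight])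
    fix s \<rho> assume s: "strict_mono s" and \<rho>: "real_distribution \<rho>" "weak_conv_m (\<mu> \<circ> s) \<rho>"
    have "\<rho> = \<nu>" using limit[OF s \<rho>] \<rho> \<nu> by (intro laplace_eq_imp_eq) auto
    with \<rho> show "weak_conv_m (\<mu> \<circ> s) \<nu>" by simp
  qed
  with \<nu> show thesis by (rule that)
qed

section \<open>The power-fractional branching process\<close>

lemma laplace_distr_pmf:
  "(LINT x|distr (measure_pmf p) borel real. exp (- u * x)) = pgf p (exp (- u))"
  by (subst integral_distr) (auto simp: pgf_def exp_of_nat_mult[symmetric] mult.commute)

text \<open>With s = exp(-u) the generating function is the Laplace transform of the law pushed to
  the reals, so uniqueness of the latter applies; at u = 0 both sides are 1.\<close>

lemma pgf_eqI:
  assumes "\<And>s. 0 < s \<Longrightarrow> s < 1 \<Longrightarrow> pgf p s = pgf q s"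
  shows "p = q"
proof -
  let ?D = "\<lambda>p. distr (measure_pmf p) borel real"
  have rd: "real_distribution (?D r)" for r
    by (intro real_distribution.intro measure_pmf.prob_space_distr) (auto simp: real_distribution_axioms_def)
  have nn: "AE x in ?D r. 0 \<le> x" for r
    by (subst AE_distr_iff) auto
  have "?D p = ?D q"
  proof (rule laplace_eq_imp_eq[OF rd nn rd nn])
    fix u :: real assume u: "0 \<le> u"
    show "(LINT x|?D p. exp (- u * x)) = (LINT x|?D q. exp (- u * x))"
      unfolding laplace_distr_pmf using u assms[of "exp (- u)"] by (cases "u = 0") (auto simp: pgf_def)
  qed
  then have "measure (?D p) {real k} = measure (?D q) {real k}" for k by simp
  then have "pmf p k = pmf q k" for k
    by (simp add: measure_distr pmf.rep_eq vimage_def)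
  then show ?thesis by (rule pmf_eqI)
qed

lemma pgf_PF:
  assumes "0 < \<theta>" "\<theta> \<le> 1" "0 < a" "0 < b" "1 \<le> a + b" "0 \<le> s" "s < 1"
  shows "pgf (PF \<theta> a b) s = 1 - (a / (1 - s) powr \<theta> + b) powr (- 1 / \<theta>)"
proof -
  let ?P = "\<lambda>p. \<forall>s\<in>{0..<1}. pgf p s = 1 - (a / (1 - s) powr \<theta> + b) powr (- 1 / \<theta>)"
  obtain p where p: "?P p" using PF_pgf_ex assms by blast
  have "?P (PF \<theta> a b)"
    unfolding PF_def
  proof (rule theI[of ?P, OF p])
    fix q assume "?P q"
    with p show "q = p" by (intro pgf_eqI) auto
  qed
  with assms show ?thesis by auto
qed

lemma pgf_bounds:
  assumes "0 \<le> s" "s \<le> 1"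
  shows "0 \<le> pgf p s" "pgf p s \<le> 1"
  unfolding pgf_def using assms
  by (auto intro!: integral_nonneg_AE measure_pmf.integral_le_const measure_pmf.integrable_const_bound[where B=1]
      simp: power_le_one)

section \<open>Composition of generating functions along the generations\<close>

lemma pgf_total_offspring:
  assumes "0 \<le> s" "s \<le> 1"
  shows "pgf (total_offspring z p) s = pgf p s ^ z"
proof -
  have "pgf (total_offspring z p) s = measure_pmf.expectation (Pi_pmf {..<z} 0 (\<lambda>_. p)) (\<lambda>\<xi>. \<Prod>i<z. s ^ \<xi> i)"
    by (simp add: pgf_def total_offspring_def power_sum)
  also have "\<dots> = (\<Prod>i<z. pgf p s)"
    unfolding pgf_def using assms
    by (intro expectation_prod_Pi_pmf)
      (auto intro!: measure_pmf.integrable_const_bound[where B=1] simp: power_le_one)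
  finally show ?thesis by simp
qed

lemma pgf_bind_pmf:
  assumes "0 \<le> s" "s \<le> 1"
  shows "pgf (bind_pmf p K) s = measure_pmf.expectation p (\<lambda>x. pgf (K x) s)"
proof -
  have eq: "ennreal (pgf r s) = (\<integral>\<^sup>+k. ennreal (s ^ k) \<partial>measure_pmf r)" for r
    unfolding pgf_def using assms
    by (intro nn_integral_eq_integral[symmetric] measure_pmf.integrable_const_bound[where B=1])
      (auto simp: power_le_one)
  have "ennreal (pgf (bind_pmf p K) s) = (\<integral>\<^sup>+x. ennreal (pgf (K x) s) \<partial>measure_pmf p)"
    unfolding eq by simp
  also have "\<dots> = ennreal (measure_pmf.expectation p (\<lambda>x. pgf (K x) s))"
    using assms by (intro nn_integral_eq_integral measure_pmf.integrable_const_bound[where B=1])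
      (auto simp: pgf_bounds)
  finally show ?thesis
    using assms by (subst (asm) ennreal_inj) (auto intro!: integral_nonneg_AE pgf_bounds)
qed

lemma length_quenched_law:
  "zs \<in> set_pmf (quenched_law \<theta> env n) \<Longrightarrow> length zs = Suc n"
  by (induction n arbitrary: zs) auto

text \<open>Given z individuals in generation n, the next generation size has generating function
  \<open>pgf p s ^ z\<close>; averaging over z evaluates the earlier generating function at
  \<open>pgf p s\<close>. The newest generation thus enters as the innermost map.\<close>

lemma pgf_quenched_law_Suc:
  assumes s: "0 \<le> s" "s \<le> 1"
  shows "pgf (map_pmf (\<lambda>zs. zs ! Suc n) (quenched_law \<theta> env (Suc n))) s =
    pgf (map_pmf (\<lambda>zs. zs ! n) (quenched_law \<theta> env n)) (pgf (offspring_law \<theta> env (Suc n)) s)"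
proof -
  have "map_pmf (\<lambda>zs. zs ! Suc n) (quenched_law \<theta> env (Suc n)) =
    bind_pmf (quenched_law \<theta> env n) (\<lambda>zs. total_offspring (zs ! n) (offspring_law \<theta> env (Suc n)))"
    unfolding quenched_law.simps map_bind_pmf
  proof (rule bind_pmf_cong[OF refl])
    fix zs assume "zs \<in> set_pmf (quenched_law \<theta> env n)"
    then have "length zs = Suc n" by (rule length_quenched_law)
    then have "(zs @ [z]) ! Suc n = z" for z by (metis nth_append_length)
    then show "map_pmf (\<lambda>zs. zs ! Suc n) (map_pmf (\<lambda>z. zs @ [z]) (total_offspring (zs ! n) (offspring_law \<theta> env (Suc n)))) =
         total_offspring (zs ! n) (offspring_law \<theta> env (Suc n))"
      by (simp add: pmf.map_comp comp_def)
  qed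
  then show ?thesis
    using s by (simp add: pgf_bind_pmf pgf_total_offspring) (simp add: pgf_def)
qed

text \<open>The pathwise form of the parameter constraints, which allows one realization to be
  treated deterministically. Index 0 governs no generation and is left free.\<close>

definition good_env :: "(nat \<Rightarrow> real \<times> real) \<Rightarrow> bool" where
  "good_env env \<longleftrightarrow> (\<forall>k\<ge>1. 0 < fst (env k) \<and> 0 < snd (env k) \<and> 1 \<le> fst (env k) + snd (env k))"

lemma env_Pi_pos: "good_env env \<Longrightarrow> 0 < env_Pi env n"
  by (auto simp: env_Pi_def good_env_def intro!: prod_pos)

lemma env_Pi_Suc: "env_Pi env (Suc n) = env_Pi env n * fst (env (Suc n))"
  by (simp add: env_Pi_def)

lemma R_inv_nonneg: "good_env env \<Longrightarrow> 0 \<le> R_inv env n"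
  unfolding R_inv_def
  by (intro sum_nonneg mult_nonneg_nonneg) (auto simp: env_Pi_pos less_imp_le good_env_def)

text \<open>The reversed environment depends on n, so the induction is over the number m of
  generations with n fixed: after m steps the entries n, ..., n - m + 1 have been used. The argument
  s stays general because each step substitutes a generating function for it.\<close>

lemma pgf_reversed_prefix:
  assumes th: "0 < \<theta>" "\<theta> \<le> 1" and env: "good_env env" and "m \<le> n" and "0 \<le> s" "s < 1"
  shows "1 - pgf (map_pmf (\<lambda>zs. zs ! m) (quenched_law \<theta> (\<lambda>k. env (n - k + 1)) m)) s =
    (env_Pi env n / env_Pi env (n - m) * (1 - s) powr (- \<theta>) +
     (\<Sum>k\<in>{n-m<..n}. env_Pi env n / env_Pi env k * snd (env k))) powr (- 1 / \<theta>)"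
  using \<open>m \<le> n\<close> \<open>0 \<le> s\<close> \<open>s < 1\<close>
proof (induction m arbitrary: s)
  case 0
  then show ?case
    using env_Pi_pos[OF env, of n] th by (simp add: pgf_def powr_powr)
next
  case (Suc m)
  \<comment> \<open>Generation \<open>Suc m\<close> reproduces by
    \<open>env (n - Suc m + 1) = env (Suc i)\<close>; the truncated subtraction is exact as
    \<open>Suc m \<le> n\<close>.\<close>
  obtain i where i: "n - m = Suc i" "n - Suc m = i" using Suc.prems by (cases "n - m") auto
  define A B where "A = fst (env (Suc i))" and "B = snd (env (Suc i))"
  have AB: "0 < A" "0 < B" "1 \<le> A + B" using env by (auto simp: good_env_def A_def B_def)
  define x where "x = A * (1 - s) powr (- \<theta>) + B"
  have x: "0 < x" using AB Suc.prems by (auto simp: x_def intro!: add_nonneg_pos)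
  have off: "offspring_law \<theta> (\<lambda>k. env (n - k + 1)) (Suc m) = PF \<theta> A B"
    using i by (simp add: offspring_law_def A_def B_def)
  let ?s = "pgf (PF \<theta> A B) s"
  have s': "?s = 1 - x powr (- 1 / \<theta>)"
    using pgf_PF[OF th AB Suc.prems(2,3)] by (simp add: x_def powr_minus_divide)
  have "?s < 1" using x unfolding s' by simp
  moreover have "0 \<le> ?s" using Suc.prems by (intro pgf_bounds) auto
  ultimately have IH: "1 - pgf (map_pmf (\<lambda>zs. zs ! m) (quenched_law \<theta> (\<lambda>k. env (n - k + 1)) m)) ?s =
    (env_Pi env n / env_Pi env (n - m) * (1 - ?s) powr (- \<theta>) +
     (\<Sum>k\<in>{n-m<..n}. env_Pi env n / env_Pi env k * snd (env k))) powr (- 1 / \<theta>)"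
    using Suc.prems by (intro Suc.IH) auto
  \<comment> \<open>In the coordinate (1 - s) powr (-\<theta>) the new generation acts as the affine
    map with slope \<open>A\<close> and intercept \<open>B\<close>.\<close>
  have powr: "(1 - ?s) powr (- \<theta>) = x"
    unfolding s' using x th by (simp add: powr_powr)
  have set: "{i<..n} = insert (Suc i) {Suc i<..n}" using i by auto
  \<comment> \<open>The intercept \<open>B\<close> supplies the new summand k = Suc i, and the slope
    \<open>A\<close> changes the denominator from \<open>env_Pi env (Suc i)\<close> to
    \<open>env_Pi env i\<close>.\<close>
  have "env_Pi env n / env_Pi env (Suc i) * x + (\<Sum>k\<in>{Suc i<..n}. env_Pi env n / env_Pi env k * snd (env k))
     = env_Pi env n / env_Pi env i * (1 - s) powr (- \<theta>) + (\<Sum>k\<in>{i<..n}. env_Pi env n / env_Pi env k * snd (env k))"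
    unfolding set using env_Pi_pos[OF env, of i] AB
    by (simp add: x_def env_Pi_Suc A_def[symmetric] B_def[symmetric] field_simps)
  note eq = this[symmetric]
  show ?case
    unfolding pgf_quenched_law_Suc[OF Suc.prems(2) less_imp_le[OF Suc.prems(3)]] off i eq
    by (rule IH[unfolded i powr])
qed

lemma pgf_reversed_law:
  assumes th: "0 < \<theta>" "\<theta> \<le> 1" and env: "good_env env" and s: "0 \<le> s" "s < 1"
  shows "pgf (map_pmf (\<lambda>zs. zs ! n) (reversed_law \<theta> env n)) s =
    1 - (env_Pi env n * ((1 - s) powr (- \<theta>) + R_inv env n)) powr (- 1 / \<theta>)"
proof -
  have "(\<Sum>k\<in>{0<..n}. env_Pi env n / env_Pi env k * snd (env k)) = env_Pi env n * R_inv env n"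
    unfolding R_inv_def sum_distrib_left by (intro sum.cong) (auto simp: field_simps)
  then show ?thesis
    using pgf_reversed_prefix[OF th env order_refl s, of n]
    by (simp add: reversed_law_def env_Pi_def[of _ 0] distrib_left)
qed

section \<open>Survival, mean and conditioning read off from the generating function\<close>

lemma prob_pos_eq_pgf: "measure_pmf.prob p {0<..} = 1 - pgf p 0"
proof -
  \<comment> \<open>By the convention \<open>0 ^ 0 = 1\<close>, the integrand \<open>0 ^ k\<close>
    is the indicator of k = 0.\<close>
  have "pgf p 0 = measure_pmf.expectation p (indicator {0})"
    unfolding pgf_def by (intro Bochner_Integration.integral_cong) (auto split: split_indicator)
  also have "\<dots> = measure_pmf.prob p {0}" by simp
  finally have "pgf p 0 = measure_pmf.prob p {0}" .
  moreover have "measure_pmf.prob p (UNIV - {0}) = 1 - measure_pmf.prob p {0}"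
    using measure_pmf.prob_compl[of "{0}" p] by simp
  moreover have "UNIV - {0} = {0::nat<..}" by auto
  ultimately show ?thesis by simp
qed

text \<open>The quotient (1 - s^k)/(1 - s) is a geometric sum that increases to k as s increases to
  1. Monotone convergence along s = 1 - 1/(j + 1) gives integrability and the value of the mean
  together.\<close>

lemma expectation_eq_pgf_slope:
  assumes lim: "((\<lambda>s. (1 - pgf p s) / (1 - s)) \<longlongrightarrow> m) (at_left 1)"
  shows "integrable (measure_pmf p) real" and "measure_pmf.expectation p real = m"
proof -
  define s :: "nat \<Rightarrow> real" where "s = (\<lambda>j. 1 - inverse (Suc j))"
  have s: "0 \<le> s j" "s j < 1" for j by (auto simp: s_def inverse_le_1_iff)
  have mono: "s i \<le> s j" if "i \<le> j" for i j using that by (simp add: s_def field_simps)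
  have s_lim: "s \<longlonglongrightarrow> 1"
    unfolding s_def using tendsto_diff[OF tendsto_const LIMSEQ_inverse_real_of_nat] by force
  have geo: "(\<Sum>i<k. s j ^ i) = (1 - s j ^ k) / (1 - s j)" for j k
    using s(2)[of j] one_diff_power_eq[of "s j" k] by (simp add: field_simps)
  have int_pow: "integrable (measure_pmf p) (\<lambda>k. s j ^ k)" for j
    using s[of j] by (intro measure_pmf.integrable_const_bound[where B=1]) (auto simp: power_le_one)
  have int: "integrable (measure_pmf p) (\<lambda>k. \<Sum>i<k. s j ^ i)" for j
    unfolding geo using int_pow by auto
  have mono': "AE k in measure_pmf p. mono (\<lambda>j. \<Sum>i<k. s j ^ i)"
    using s mono by (auto intro!: monoI sum_mono power_mono)
  have lim': "AE k in measure_pmf p. (\<lambda>j. \<Sum>i<k. s j ^ i) \<longlonglongrightarrow> real k"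
  proof (rule AE_I2)
    fix k
    have "(\<lambda>j. \<Sum>i<k. s j ^ i) \<longlonglongrightarrow> (\<Sum>i<k. 1 ^ i)" by (intro tendsto_sum tendsto_power s_lim)
    then show "(\<lambda>j. \<Sum>i<k. s j ^ i) \<longlonglongrightarrow> real k" by simp
  qed
  have "filterlim s (at_left 1) sequentially"
    unfolding filterlim_at using s s_lim by (auto simp: less_imp_neq)
  from filterlim_compose[OF lim this] have "(\<lambda>j. (1 - pgf p (s j)) / (1 - s j)) \<longlonglongrightarrow> m" .
  also have "(\<lambda>j. (1 - pgf p (s j)) / (1 - s j)) = (\<lambda>j. measure_pmf.expectation p (\<lambda>k. \<Sum>i<k. s j ^ i))"
    unfolding geo pgf_def using int_pow by (simp add: Bochner_Integration.integral_diff)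
  finally have ilim: "(\<lambda>j. measure_pmf.expectation p (\<lambda>k. \<Sum>i<k. s j ^ i)) \<longlonglongrightarrow> m" .
  show "integrable (measure_pmf p) real" "measure_pmf.expectation p real = m"
    using integrable_monotone_convergence[OF int mono' lim' ilim]
      integral_monotone_convergence[OF int mono' lim' ilim] by auto
qed

lemma expectation_cond_pmf:
  fixes f :: "'a \<Rightarrow> real"
  assumes pos: "0 < measure_pmf.prob p S"
  shows "measure_pmf.expectation (cond_pmf p S) f =
    measure_pmf.expectation p (\<lambda>x. indicator S x * f x) / measure_pmf.prob p S"
proof -
  have "set_pmf p \<inter> S \<noteq> {}"
  proof
    assume "set_pmf p \<inter> S = {}"
    then have "measure_pmf.prob p S = 0" by (subst measure_pmf_zero_iff) auto
    with pos show False by simp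
  qed
  then have "measure_pmf (cond_pmf p S) = density (measure_pmf p) (\<lambda>x. ennreal (indicator S x / measure_pmf.prob p S))"
    using pos by (auto simp: cond_pmf.rep_eq uniform_measure_def measure_pmf.emeasure_eq_measure divide_ennreal
        ennreal_indicator[symmetric] intro!: density_cong)
  then have "measure_pmf.expectation (cond_pmf p S) f =
      measure_pmf.expectation p (\<lambda>x. (indicator S x / measure_pmf.prob p S) *\<^sub>R f x)"
    by (simp add: integral_density)
  also have "\<dots> = measure_pmf.expectation p (\<lambda>x. indicator S x * f x / measure_pmf.prob p S)"
    by simp
  finally show ?thesis by simp
qed

lemma pgf_cond_pos:
  assumes "pgf p 0 < 1" "0 \<le> s" "s \<le> 1"
  shows "pgf (cond_pmf p {0<..}) s = 1 - (1 - pgf p s) / (1 - pgf p 0)"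
proof -
  have int: "integrable (measure_pmf p) (\<lambda>k. t ^ k)" if "0 \<le> t" "t \<le> 1" for t :: real
    using that by (intro measure_pmf.integrable_const_bound[where B=1]) (auto simp: power_le_one)
  \<comment> \<open>Subtracting \<open>0 ^ k\<close> removes exactly the term k = 0.\<close>
  have "measure_pmf.expectation p (\<lambda>k. indicator {0<..} k * s ^ k) = measure_pmf.expectation p (\<lambda>k. s ^ k - 0 ^ k)"
    by (intro Bochner_Integration.integral_cong) (auto split: split_indicator)
  also have "\<dots> = pgf p s - pgf p 0"
    using int assms by (simp add: pgf_def)
  finally show ?thesis
    using assms(1) by (simp add: pgf_def[of "cond_pmf _ _"] expectation_cond_pmf prob_pos_eq_pgf field_simps)
qed

lemma expectation_cond_pos:
  assumes "pgf p 0 < 1"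
  shows "measure_pmf.expectation (cond_pmf p {0<..}) real = measure_pmf.expectation p real / (1 - pgf p 0)"
proof -
  have "measure_pmf.expectation p (\<lambda>k. indicator {0<..} k * real k) = measure_pmf.expectation p real"
    by (intro Bochner_Integration.integral_cong) (auto split: split_indicator)
  with assms show ?thesis by (simp add: expectation_cond_pmf prob_pos_eq_pgf)
qed

text \<open>An infinite \<open>ennreal\<close> series of nonnegative reals is not summable, so its
  increasing partial sums are unbounded.\<close>

lemma R_inv_at_top:
  assumes env: "good_env env" and inf: "R_inv_inf env = \<infinity>"
  shows "filterlim (R_inv env) at_top sequentially"
proof -
  let ?f = "\<lambda>k. inverse (env_Pi env (Suc k)) * snd (env (Suc k))"
  have nn: "0 \<le> ?f k" for k
    using env_Pi_pos[OF env, of "Suc k"] env by (intro mult_nonneg_nonneg) (auto simp: good_env_def less_imp_le)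
  have R: "R_inv env n = (\<Sum>k<n. ?f k)" for n
    unfolding R_inv_def One_nat_def by (subst sum.atLeast1_atMost_eq) simp
  have "\<not> summable ?f"
    using inf ennreal_suminf_neq_top[of ?f] nn by (auto simp: R_inv_inf_def)
  then have unb: "\<exists>n. B < R_inv env n" for B
    using summableI_nonneg_bounded[of ?f B] nn unfolding R by (meson not_le)
  have mono: "R_inv env m \<le> R_inv env n" if "m \<le> n" for m n
    unfolding R using that nn by (intro sum_mono2) auto
  show ?thesis
    unfolding filterlim_at_top eventually_sequentially
    using unb mono by (meson less_imp_le order_trans)
qed

text \<open>Applied with p = \<open>env_Pi env n\<close>, this is how the product of the
  \<open>A\<close> components drops out of every quantity conditioned on survival.\<close>

lemma powr_minus_ratio:
  fixes a b c p :: real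
  assumes "0 < p" "0 < a" "0 < b"
  shows "(p * b) powr (- c) / (p * a) powr (- c) = (a / b) powr c"
proof -
  have "(p * b) powr (- c) / (p * a) powr (- c) = (p * b / (p * a)) powr (- c)"
    using assms by (simp only: powr_divide mult_pos_pos less_imp_le)
  also have "p * b / (p * a) = inverse (a / b)" using assms by simp
  also have "inverse (a / b) powr (- c) = (a / b) powr c"
    using assms by (simp add: powr_minus powr_divide)
  finally show ?thesis .
qed

lemma tendsto_ratio_at_top:
  assumes "filterlim R at_top F"
  shows "((\<lambda>n. R n / (1 + R n)) \<longlongrightarrow> (1::real)) F"
proof -
  have "filterlim (\<lambda>n. 1 + R n) at_top F"
    using assms by (intro filterlim_tendsto_add_at_top[OF tendsto_const])
  then have "((\<lambda>n. 1 - inverse (1 + R n)) \<longlongrightarrow> 1 - 0) F"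
    by (intro tendsto_diff tendsto_const tendsto_inverse_0_at_top)
  moreover have "\<forall>\<^sub>F n in F. 1 - inverse (1 + R n) = R n / (1 + R n)"
    using filterlim_at_top_dense[THEN iffD1, OF assms, rule_format, of 0]
    by eventually_elim (simp add: field_simps)
  ultimately show ?thesis by (simp add: filterlim_cong)
qed

section \<open>Exact formulas for a fixed environment in reversed order\<close>

abbreviation reversed_final :: "real \<Rightarrow> (nat \<Rightarrow> real \<times> real) \<Rightarrow> nat \<Rightarrow> nat pmf" where
  "reversed_final \<theta> env n \<equiv> map_pmf (\<lambda>zs. zs ! n) (reversed_law \<theta> env n)"

context
  fixes \<theta> :: real and env :: "nat \<Rightarrow> real \<times> real"
  assumes th: "0 < \<theta>" "\<theta> \<le> 1" and env: "good_env env"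
begin

lemma survival_pgf:
  "1 - pgf (reversed_final \<theta> env n) 0 = (env_Pi env n * (1 + R_inv env n)) powr (- 1 / \<theta>)"
  by (simp add: pgf_reversed_law[OF th env])

lemma survival_pos: "pgf (reversed_final \<theta> env n) 0 < 1"
proof -
  have "0 < env_Pi env n * (1 + R_inv env n)"
    using env_Pi_pos[OF env, of n] R_inv_nonneg[OF env, of n] by simp
  then have "0 < (env_Pi env n * (1 + R_inv env n)) powr (- 1 / \<theta>)"
    by (simp only: powr_gt_zero less_imp_neq[symmetric] not_False_eq_True)
  then show ?thesis using survival_pgf[of n] by linarith
qed

lemma prob_survival:
  "measure_pmf.prob (reversed_law \<theta> env n) (survival n) = (env_Pi env n * (1 + R_inv env n)) powr (- 1 / \<theta>)"
proof -
  have "measure_pmf.prob (reversed_law \<theta> env n) (survival n) = measure_pmf.prob (reversed_final \<theta> env n) {0<..}"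
    by (simp add: survival_def vimage_def)
  then show ?thesis by (simp only: prob_pos_eq_pgf survival_pgf)
qed

text \<open>Survival depends on the path only through its last entry, so conditioning commutes with
  the projection onto that entry.\<close>

lemma cond_reversed_final:
  "cond_pmf (reversed_final \<theta> env n) {0<..} = map_pmf (\<lambda>zs. zs ! n) (cond_pmf (reversed_law \<theta> env n) (survival n))"
proof -
  have S: "survival n = (\<lambda>zs. zs ! n) -` {0<..}" by (auto simp: survival_def)
  have "set_pmf (reversed_law \<theta> env n) \<inter> survival n \<noteq> {}"
  proof
    assume "set_pmf (reversed_law \<theta> env n) \<inter> survival n = {}"
    then have "measure_pmf.prob (reversed_law \<theta> env n) (survival n) = 0"
      by (subst measure_pmf_zero_iff) auto
    then show False
      using survival_pos[of n] survival_pgf[of n] prob_survival[of n] by linarith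
  qed
  then show ?thesis unfolding S by (rule cond_map_pmf)
qed

text \<open>Factoring (1 - s) powr (-\<theta>) out of the bracket in 1 - F(s) gives (1 - F(s))/(1 -
  s) = (P (1 + R (1 - s) powr \<theta>)) powr (-1/\<theta>), whose left limit at 1 is P powr
  (-1/\<theta>).\<close>

lemma expectation_reversed_final:
  "measure_pmf.expectation (reversed_final \<theta> env n) real = env_Pi env n powr (- 1 / \<theta>)"
proof (rule expectation_eq_pgf_slope(2))
  let ?P = "env_Pi env n" and ?R = "R_inv env n"
  have P: "0 < ?P" and R: "0 \<le> ?R" using env_Pi_pos[OF env] R_inv_nonneg[OF env] by auto
  have "((\<lambda>s::real. (1 - s) powr \<theta>) \<longlongrightarrow> 0 powr \<theta>) (at_left 1)"
    using th by (intro tendsto_powr2) (auto intro!: tendsto_eq_intros eventually_at_leftI[of 0])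
  then have "((\<lambda>s. ?P * (1 + ?R * (1 - s) powr \<theta>)) \<longlongrightarrow> ?P * (1 + ?R * 0)) (at_left 1)"
    by (intro tendsto_mult tendsto_add tendsto_const) simp
  then have "((\<lambda>s. (?P * (1 + ?R * (1 - s) powr \<theta>)) powr (- 1 / \<theta>)) \<longlongrightarrow> (?P * (1 + ?R * 0)) powr (- 1 / \<theta>)) (at_left 1)"
    using P by (intro tendsto_powr tendsto_const) auto
  moreover have "\<forall>\<^sub>F s in at_left 1. (?P * (1 + ?R * (1 - s) powr \<theta>)) powr (- 1 / \<theta>) =
     (1 - pgf (reversed_final \<theta> env n) s) / (1 - s)"
  proof (rule eventually_at_leftI[of 0])
    fix s :: real assume "s \<in> {0<..<1}"
    then have s: "0 \<le> s" "s < 1" by auto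
    have "?P * ((1 - s) powr (- \<theta>) + ?R) = (1 - s) powr (- \<theta>) * (?P * (1 + ?R * (1 - s) powr \<theta>))"
      using s by (simp add: powr_minus field_simps)
    also have "\<dots> powr (- 1 / \<theta>) = (1 - s) * (?P * (1 + ?R * (1 - s) powr \<theta>)) powr (- 1 / \<theta>)"
      using s th P R by (subst powr_mult) (auto simp: powr_powr)
    finally show "(?P * (1 + ?R * (1 - s) powr \<theta>)) powr (- 1 / \<theta>) = (1 - pgf (reversed_final \<theta> env n) s) / (1 - s)"
      using s by (simp add: pgf_reversed_law[OF th env s])
  qed simp
  ultimately show "((\<lambda>s. (1 - pgf (reversed_final \<theta> env n) s) / (1 - s)) \<longlongrightarrow> ?P powr (- 1 / \<theta>)) (at_left 1)"
    by (simp add: filterlim_cong)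
qed

lemma expectation_given_survival:
  "measure_pmf.expectation (cond_pmf (reversed_law \<theta> env n) (survival n)) (\<lambda>zs. real (zs ! n)) =
    (1 + R_inv env n) powr (1 / \<theta>)"
proof -
  have "measure_pmf.expectation (cond_pmf (reversed_law \<theta> env n) (survival n)) (\<lambda>zs. real (zs ! n)) =
     measure_pmf.expectation (cond_pmf (reversed_final \<theta> env n) {0<..}) real"
    unfolding cond_reversed_final by simp
  also have "\<dots> = env_Pi env n powr (- 1 / \<theta>) / (env_Pi env n * (1 + R_inv env n)) powr (- 1 / \<theta>)"
    unfolding expectation_cond_pos[OF survival_pos] expectation_reversed_final survival_pgf ..
  also have "\<dots> = (1 + R_inv env n) powr (1 / \<theta>)"
    using powr_minus_ratio[of "env_Pi env n" "1 + R_inv env n" 1 "1 / \<theta>"] env_Pi_pos[OF env, of n]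
      R_inv_nonneg[OF env, of n] by simp
  finally show ?thesis .
qed

lemma laplace_given_survival:
  assumes "0 < u"
  shows "pgf (cond_pmf (reversed_final \<theta> env n) {0<..}) (exp (- u)) =
    1 - ((1 + R_inv env n) / ((1 - exp (- u)) powr (- \<theta>) + R_inv env n)) powr (1 / \<theta>)"
proof -
  let ?P = "env_Pi env n" and ?R = "R_inv env n" and ?x = "(1 - exp (- u)) powr (- \<theta>)"
  have P: "0 < ?P" and R: "0 \<le> ?R" using env_Pi_pos[OF env] R_inv_nonneg[OF env] by auto
  have x: "0 < ?x" using assms by simp
  have "(?P * (?x + ?R)) powr (- 1 / \<theta>) / (?P * (1 + ?R)) powr (- 1 / \<theta>) = ((1 + ?R) / (?x + ?R)) powr (1 / \<theta>)"
    using powr_minus_ratio[of ?P "1 + ?R" "?x + ?R" "1 / \<theta>"] P R x by simp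
  moreover have "1 - pgf (reversed_final \<theta> env n) (exp (- u)) = (?P * (?x + ?R)) powr (- 1 / \<theta>)"
    using assms pgf_reversed_law[OF th env, of "exp (- u)" n] by simp
  moreover have "pgf (cond_pmf (reversed_final \<theta> env n) {0<..}) (exp (- u)) =
      1 - (1 - pgf (reversed_final \<theta> env n) (exp (- u))) / (1 - pgf (reversed_final \<theta> env n) 0)"
    using assms by (intro pgf_cond_pos survival_pos) auto
  ultimately show ?thesis by (simp only: survival_pgf)
qed

end

section \<open>Asymptotics\<close>

lemma powr_at_top:
  assumes "0 < (p::real)"
  shows "filterlim (\<lambda>x::real. x powr p) at_top at_top"
proof -
  have "filterlim (\<lambda>x. exp (p * ln x)) at_top at_top"
    by (intro filterlim_compose[OF exp_at_top] filterlim_tendsto_pos_mult_at_top[OF tendsto_const] assms ln_at_top)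
  moreover have "\<forall>\<^sub>F x in at_top. exp (p * ln x) = x powr p"
    using eventually_gt_at_top[of "0::real"] by eventually_elim (simp add: powr_def)
  ultimately show ?thesis by (simp cong: filterlim_cong)
qed

text \<open>The definition demands full mass on the open halfline. An atom at 0 would bound the
  transform from below at every u, yet the transform tends to 0 as u grows. Uniqueness of the
  transform then settles the definite description.\<close>

lemma CPF_plus_eqI:
  assumes th: "0 < \<theta>" and al: "0 < \<alpha>"
    and \<nu>: "real_distribution \<nu>" "AE x in \<nu>. 0 \<le> x"
    and L: "\<And>u. 0 \<le> u \<Longrightarrow> (LINT x|\<nu>. exp (- u * x)) = 1 - (u powr \<theta> / (u powr \<theta> + \<alpha>)) powr (1 / \<theta>)"
  shows "CPF_plus \<theta> \<alpha> = \<nu>"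
  unfolding CPF_plus_def
proof (rule the_equality)
  interpret \<nu>: real_distribution \<nu> by fact
  have zero: "measure \<nu> {0} \<le> 1 - (u powr \<theta> / (u powr \<theta> + \<alpha>)) powr (1 / \<theta>)" if u: "0 \<le> u" for u
  proof -
    have "measure \<nu> {0} = (LINT x|\<nu>. indicator {0} x)" by simp
    also have "\<dots> \<le> (LINT x|\<nu>. exp (- u * x))"
      using u by (intro integral_mono laplace_integrable \<nu>)
        (auto simp: \<nu>.prob_space_axioms integrable_indicator_iff \<nu>.emeasure_eq_measure split: split_indicator)
    finally show ?thesis using L[OF u] by simp
  qed
  have "filterlim (\<lambda>u::real. u powr \<theta>) at_top at_top"
    using th by (intro powr_at_top)
  then have "filterlim (\<lambda>u. u powr \<theta> + \<alpha>) at_top at_top"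
    using filterlim_tendsto_add_at_top[OF tendsto_const[of \<alpha>]] by (simp add: add.commute)
  then have "((\<lambda>u. (1 - \<alpha> * inverse (u powr \<theta> + \<alpha>)) powr (1 / \<theta>)) \<longlongrightarrow> (1 - \<alpha> * 0) powr (1 / \<theta>)) at_top"
    by (intro tendsto_powr tendsto_diff tendsto_mult tendsto_const tendsto_inverse_0_at_top) auto
  moreover have "1 - \<alpha> * inverse (u powr \<theta> + \<alpha>) = u powr \<theta> / (u powr \<theta> + \<alpha>)" for u
    using al by (simp add: field_simps add_nonneg_eq_0_iff)
  ultimately have "((\<lambda>u. 1 - (u powr \<theta> / (u powr \<theta> + \<alpha>)) powr (1 / \<theta>)) \<longlongrightarrow> 1 - 1) at_top"
    by (intro tendsto_diff tendsto_const) simp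
  moreover have "\<forall>\<^sub>F u in at_top. measure \<nu> {0} \<le> 1 - (u powr \<theta> / (u powr \<theta> + \<alpha>)) powr (1 / \<theta>)"
    using eventually_ge_at_top[of "0::real"] by eventually_elim (rule zero)
  ultimately have "measure \<nu> {0} \<le> 1 - 1"
    by (rule tendsto_lowerbound) simp
  then have m0: "measure \<nu> {0} = 0" by (simp add: measure_le_0_iff)
  have "AE x in \<nu>. x \<noteq> 0"
    using m0 by (intro AE_I[of _ _ "{0}"]) (auto simp: \<nu>.emeasure_eq_measure)
  with \<nu>(2) have "AE x in \<nu>. x \<in> {0<..}" by eventually_elim auto
  then have "measure \<nu> {0<..} = 1" by (intro \<nu>.prob_eq_1[THEN iffD2]) auto
  with \<nu> L show "real_distribution \<nu> \<and> measure \<nu> {0<..} = 1 \<and>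
     (\<forall>u\<ge>0. (LINT x|\<nu>. exp (- u * x)) = 1 - (u powr \<theta> / (u powr \<theta> + \<alpha>)) powr (1 / \<theta>))" by auto
  fix \<mu> assume \<mu>: "real_distribution \<mu> \<and> measure \<mu> {0<..} = 1 \<and>
     (\<forall>u\<ge>0. (LINT x|\<mu>. exp (- u * x)) = 1 - (u powr \<theta> / (u powr \<theta> + \<alpha>)) powr (1 / \<theta>))"
  then interpret \<mu>: real_distribution \<mu> by simp
  have "AE x in \<mu>. x \<in> {0<..}" using \<mu> by (intro \<mu>.prob_eq_1[THEN iffD1]) auto
  then have "AE x in \<mu>. 0 \<le> x" by eventually_elim auto
  then show "\<mu> = \<nu>" using \<mu> \<nu> L by (intro laplace_eq_imp_eq) auto
qed

text \<open>A difference quotient of -exp(-u h) at h = 0, whose derivative there is u, sampled along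
  h = 1 / R powr \<gamma>, which tends to 0.\<close>

lemma one_minus_exp_slope:
  fixes u :: real
  assumes R: "filterlim R at_top F" and "0 < (\<gamma>::real)"
  shows "((\<lambda>n. (1 - exp (- (u / R n powr \<gamma>))) * R n powr \<gamma>) \<longlongrightarrow> u) F"
proof -
  have top: "filterlim (\<lambda>n. R n powr \<gamma>) at_top F"
    by (rule filterlim_compose[OF powr_at_top R]) fact
  have D: "((\<lambda>h::real. - exp (- (u * h))) has_real_derivative u) (at 0)"
    by (auto intro!: derivative_eq_intros)
  have "((\<lambda>h::real. (1 - exp (- (u * h))) / h) \<longlongrightarrow> u) (at 0)"
    using D unfolding has_field_derivative_iff by simp
  moreover have "filterlim (\<lambda>n. inverse (R n powr \<gamma>)) (at 0) F"
    using filterlim_compose[OF filterlim_inverse_at_right_top top] by (rule filterlim_mono) (auto simp: at_within_le_at)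
  ultimately have "((\<lambda>n. (1 - exp (- (u * inverse (R n powr \<gamma>)))) / inverse (R n powr \<gamma>)) \<longlongrightarrow> u) F"
    by (rule filterlim_compose)
  then show ?thesis by (simp add: divide_inverse)
qed

section \<open>Limits for a fixed environment with \<open>R_inv env n\<close> tending to
  infinity\<close>

context
  fixes \<theta> :: real and env :: "nat \<Rightarrow> real \<times> real"
  assumes th: "0 < \<theta>" "\<theta> \<le> 1" and env: "good_env env" and inf: "R_inv_inf env = \<infinity>"
begin

lemma R_top: "filterlim (R_inv env) at_top sequentially"
  by (rule R_inv_at_top[OF env inf])

lemma R_pos: "\<forall>\<^sub>F n in sequentially. 0 < R_inv env n"
  using R_top by (simp add: filterlim_at_top_dense)

lemma ratio_powr: "(\<lambda>n. (R_inv env n / (1 + R_inv env n)) powr c) \<longlonglongrightarrow> 1"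
  using tendsto_powr[OF tendsto_ratio_at_top[OF R_top] tendsto_const, of c] by simp

lemma survival_asymptotics:
  "(\<lambda>n. (env_Pi env n * R_inv env n) powr (1 / \<theta>) *
     measure_pmf.prob (reversed_law \<theta> env n) (survival n)) \<longlonglongrightarrow> 1"
proof (rule Lim_transform_eventually[OF ratio_powr[of "1 / \<theta>"]])
  show "\<forall>\<^sub>F n in sequentially. (R_inv env n / (1 + R_inv env n)) powr (1 / \<theta>) =
     (env_Pi env n * R_inv env n) powr (1 / \<theta>) * measure_pmf.prob (reversed_law \<theta> env n) (survival n)"
    using R_pos
  proof eventually_elim
    case (elim n)
    have "(env_Pi env n * R_inv env n) powr (1 / \<theta>) * (env_Pi env n * (1 + R_inv env n)) powr (- (1 / \<theta>)) =
        ((env_Pi env n * R_inv env n) / (env_Pi env n * (1 + R_inv env n))) powr (1 / \<theta>)"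
      unfolding powr_minus divide_inverse[symmetric] by (rule powr_divide[symmetric])
    then show ?case using env_Pi_pos[OF env, of n] by (simp add: prob_survival[OF th env])
  qed
qed

lemma expectation_asymptotics:
  "(\<lambda>n. R_inv env n powr (- 1 / \<theta>) *
     measure_pmf.expectation (cond_pmf (reversed_law \<theta> env n) (survival n)) (\<lambda>zs. real (zs ! n))) \<longlonglongrightarrow> 1"
proof (rule Lim_transform_eventually[OF ratio_powr[of "- 1 / \<theta>"]])
  show "\<forall>\<^sub>F n in sequentially. (R_inv env n / (1 + R_inv env n)) powr (- 1 / \<theta>) = R_inv env n powr (- 1 / \<theta>) *
     measure_pmf.expectation (cond_pmf (reversed_law \<theta> env n) (survival n)) (\<lambda>zs. real (zs ! n))"
    using R_pos
  proof eventually_elim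
    case (elim n)
    then show ?case
      by (simp add: expectation_given_survival[OF th env] powr_divide powr_minus divide_simps)
  qed
qed

lemma laplace_asymptotics:
  assumes u: "0 < u"
  shows "(\<lambda>n. pgf (cond_pmf (reversed_final \<theta> env n) {0<..}) (exp (- (u / R_inv env n powr (1 / \<theta>)))))
    \<longlonglongrightarrow> 1 - (u powr \<theta> / (u powr \<theta> + 1)) powr (1 / \<theta>)"
proof -
  let ?R = "R_inv env" and ?x = "\<lambda>n. 1 - exp (- (u / R_inv env n powr (1 / \<theta>)))"
  have "(\<lambda>n. ?x n * ?R n powr (1 / \<theta>)) \<longlonglongrightarrow> u"
    using th by (intro one_minus_exp_slope R_top) auto
  then have "(\<lambda>n. (?x n * ?R n powr (1 / \<theta>)) powr (- \<theta>)) \<longlonglongrightarrow> u powr (- \<theta>)"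
    using u by (intro tendsto_powr tendsto_const) auto
  \<comment> \<open>With x for \<open>?x n\<close> and R for \<open>?R n\<close>, the conditional
    transform involves (x powr (-\<theta>) + R)/(1 + R). Since x powr (-\<theta>) = R (x R powr
    (1/\<theta>)) powr (-\<theta>), this equals the product below, each factor of which
    converges.\<close>
  then have "(\<lambda>n. ?R n / (1 + ?R n) * ((?x n * ?R n powr (1 / \<theta>)) powr (- \<theta>) + 1)) \<longlonglongrightarrow> 1 * (u powr (- \<theta>) + 1)"
    by (intro tendsto_mult tendsto_add tendsto_const tendsto_ratio_at_top R_top)
  moreover have "u powr (- \<theta>) + 1 > 0" by (simp add: add_nonneg_pos)
  ultimately have "(\<lambda>n. 1 - (?R n / (1 + ?R n) * ((?x n * ?R n powr (1 / \<theta>)) powr (- \<theta>) + 1)) powr (- (1 / \<theta>)))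
      \<longlonglongrightarrow> 1 - (1 * (u powr (- \<theta>) + 1)) powr (- (1 / \<theta>))"
    by (intro tendsto_diff tendsto_powr tendsto_const) auto
  also have "(1 * (u powr (- \<theta>) + 1)) powr (- (1 / \<theta>)) = (u powr \<theta> / (u powr \<theta> + 1)) powr (1 / \<theta>)"
  proof -
    have "u powr (- \<theta>) + 1 = inverse (u powr \<theta> / (u powr \<theta> + 1))"
      using u by (simp add: powr_minus field_simps)
    then show ?thesis using u by (simp add: powr_minus powr_divide)
  qed
  finally have "(\<lambda>n. 1 - (?R n / (1 + ?R n) * ((?x n * ?R n powr (1 / \<theta>)) powr (- \<theta>) + 1)) powr (- (1 / \<theta>)))
      \<longlonglongrightarrow> 1 - (u powr \<theta> / (u powr \<theta> + 1)) powr (1 / \<theta>)" .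
  then show ?thesis
  proof (rule Lim_transform_eventually)
    show "\<forall>\<^sub>F n in sequentially. 1 - (?R n / (1 + ?R n) * ((?x n * ?R n powr (1 / \<theta>)) powr (- \<theta>) + 1)) powr (- (1 / \<theta>)) =
       pgf (cond_pmf (reversed_final \<theta> env n) {0<..}) (exp (- (u / ?R n powr (1 / \<theta>))))"
      using R_pos
    proof eventually_elim
      case (elim n)
      have pos: "0 < u / ?R n powr (1 / \<theta>)" using u elim by simp
      then have x: "0 < ?x n" by simp
      have "(?x n * ?R n powr (1 / \<theta>)) powr (- \<theta>) = ?x n powr (- \<theta>) * inverse (?R n)"
        using x elim th by (subst powr_mult) (auto simp: powr_powr powr_minus_divide divide_simps)
      then have "?R n / (1 + ?R n) * ((?x n * ?R n powr (1 / \<theta>)) powr (- \<theta>) + 1) =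
          (?x n powr (- \<theta>) + ?R n) / (1 + ?R n)"
        using elim by (simp add: field_simps)
      also have "\<dots> powr (- (1 / \<theta>)) = ((1 + ?R n) / (?x n powr (- \<theta>) + ?R n)) powr (1 / \<theta>)"
        unfolding powr_minus powr_divide by simp
      finally have "(?R n / (1 + ?R n) * ((?x n * ?R n powr (1 / \<theta>)) powr (- \<theta>) + 1)) powr (- (1 / \<theta>)) =
          ((1 + ?R n) / (?x n powr (- \<theta>) + ?R n)) powr (1 / \<theta>)" .
      then show ?case using laplace_given_survival[OF th env pos, of n] by simp
    qed
  qed
qed

lemma weak_limit:
  "weak_conv_m (\<lambda>n. distr (measure_pmf (cond_pmf (reversed_law \<theta> env n) (survival n))) borel
     (\<lambda>zs. real (zs ! n) / R_inv env n powr (1 / \<theta>))) (CPF_plus \<theta> 1)"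
proof -
  let ?C = "\<lambda>n. cond_pmf (reversed_law \<theta> env n) (survival n)" and ?c = "\<lambda>n. R_inv env n powr (1 / \<theta>)"
  let ?\<mu> = "\<lambda>n. distr (measure_pmf (?C n)) borel (\<lambda>zs. real (zs ! n) / ?c n)"
  let ?L = "\<lambda>u. 1 - (u powr \<theta> / (u powr \<theta> + 1)) powr (1 / \<theta>)"
  \<comment> \<open>This includes n = 0, where \<open>R_inv env 0 = 0\<close> and division by zero
    makes the law the point mass at 0.\<close>
  have rd: "real_distribution (?\<mu> n)" for n
    by (intro real_distribution.intro measure_pmf.prob_space_distr) (auto simp: real_distribution_axioms_def)
  have nn: "AE x in ?\<mu> n. 0 \<le> x" for n
    by (subst AE_distr_iff) auto
  have lap: "(LINT x|?\<mu> n. exp (- u * x)) = pgf (cond_pmf (reversed_final \<theta> env n) {0<..}) (exp (- (u / ?c n)))" for u n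
    unfolding cond_reversed_final[OF th env]
    by (subst integral_distr) (auto simp: pgf_def exp_of_nat_mult[symmetric] mult.commute)
  have lim: "(\<lambda>n. LINT x|?\<mu> n. exp (- u * x)) \<longlonglongrightarrow> ?L u" if "0 \<le> u" for u
  proof (cases "u = 0")
    \<comment> \<open>Since \<open>0 powr c = 0\<close>, the limit \<open>?L 0\<close> is 1, as is
      every transform at 0.\<close>
    case True
    then show ?thesis unfolding lap by (simp add: pgf_def)
  next
    case False
    with that show ?thesis unfolding lap by (intro laplace_asymptotics) auto
  qed
  have L1: "(?L \<longlongrightarrow> 1) (at_right 0)"
  proof -
    have "((\<lambda>u::real. u powr \<theta>) \<longlongrightarrow> 0 powr \<theta>) (at_right 0)"
      using th by (intro tendsto_powr2) (auto intro!: tendsto_eq_intros eventually_at_rightI[of 0 1])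
    then have "((\<lambda>u::real. u powr \<theta> / (u powr \<theta> + 1)) \<longlongrightarrow> 0 / (0 + 1)) (at_right 0)"
      by (intro tendsto_divide tendsto_add tendsto_const) auto
    then have "((\<lambda>u::real. (u powr \<theta> / (u powr \<theta> + 1)) powr (1 / \<theta>)) \<longlongrightarrow> 0 powr (1 / \<theta>)) (at_right 0)"
      using th by (intro tendsto_powr2) (auto intro!: always_eventually divide_nonneg_nonneg)
    then have "(?L \<longlongrightarrow> 1 - 0 powr (1 / \<theta>)) (at_right 0)"
      by (intro tendsto_diff tendsto_const)
    then show ?thesis by simp
  qed
  obtain \<nu> where \<nu>: "real_distribution \<nu>" "AE x in \<nu>. 0 \<le> x"
      "\<forall>u\<ge>0. (LINT x|\<nu>. exp (- u * x)) = ?L u" "weak_conv_m ?\<mu> \<nu>"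
    by (rule laplace_continuity[OF rd nn lim L1])
  have "CPF_plus \<theta> 1 = \<nu>" using th \<nu> by (intro CPF_plus_eqI) auto
  with \<nu> show ?thesis by simp
qed

end

section \<open>From single realizations to almost every environment\<close>

theorem theorem6p3:
  fixes M :: "'w measure" and e :: "nat \<Rightarrow> 'w \<Rightarrow> real \<times> real" and \<theta> :: real
  assumes "prob_space M"
    and "0 < \<theta>" and "\<theta> \<le> 1"
    and indep: "prob_space.indep_vars M (\<lambda>_. borel) e {1..}"
    and ident: "\<And>n. n \<ge> 1 \<Longrightarrow> distr M borel (e n) = distr M borel (e 1)"
    and param: "\<And>n. n \<ge> 1 \<Longrightarrow>
      AE \<omega> in M. fst (e n \<omega>) > 0 \<and> snd (e n \<omega>) > 0 \<and> fst (e n \<omega>) + snd (e n \<omega>) \<ge> 1"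
    and crit: "AE \<omega> in M. R_inf (\<lambda>k. e k \<omega>) = \<infinity> \<and> R_inv_inf (\<lambda>k. e k \<omega>) = \<infinity>"
    and nondeg: "measure M {\<omega> \<in> space M. fst (e 1 \<omega>) \<noteq> 1} > 0"
  shows "(AE \<omega> in M.
        (\<lambda>n. (env_Pi (\<lambda>k. e k \<omega>) n * R_inv (\<lambda>k. e k \<omega>) n) powr (1 / \<theta>) *
             measure_pmf.prob (reversed_law \<theta> (\<lambda>k. e k \<omega>) n) (survival n))
          \<longlonglongrightarrow> 1)
    \<and> (AE \<omega> in M.
        (\<lambda>n. R_inv (\<lambda>k. e k \<omega>) n powr (- 1 / \<theta>) *
             measure_pmf.expectation (cond_pmf (reversed_law \<theta> (\<lambda>k. e k \<omega>) n) (survival n))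
               (\<lambda>zs. real (zs ! n)))
          \<longlonglongrightarrow> 1)
    \<and> (AE \<omega> in M.
        weak_conv_m
          (\<lambda>n. distr (measure_pmf (cond_pmf (reversed_law \<theta> (\<lambda>k. e k \<omega>) n) (survival n))) borel
             (\<lambda>zs. real (zs ! n) / R_inv (\<lambda>k. e k \<omega>) n powr (1 / \<theta>)))
          (CPF_plus \<theta> 1))"
proof -
  \<comment> \<open>Countably many almost sure constraints hold simultaneously, so almost every
    realization falls under the deterministic results.\<close>
  have "AE \<omega> in M. \<forall>n. 1 \<le> n \<longrightarrow>
      fst (e n \<omega>) > 0 \<and> snd (e n \<omega>) > 0 \<and> fst (e n \<omega>) + snd (e n \<omega>) \<ge> 1"
    unfolding AE_all_countable using param by (auto simp: AE_conj_iff)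
  with crit have good: "AE \<omega> in M. good_env (\<lambda>k. e k \<omega>) \<and> R_inv_inf (\<lambda>k. e k \<omega>) = \<infinity>"
    by eventually_elim (auto simp: good_env_def)
  note th = \<open>0 < \<theta>\<close> \<open>\<theta> \<le> 1\<close>
  show ?thesis
  proof (intro conjI)
    show "AE \<omega> in M.
        (\<lambda>n. (env_Pi (\<lambda>k. e k \<omega>) n * R_inv (\<lambda>k. e k \<omega>) n) powr (1 / \<theta>) *
             measure_pmf.prob (reversed_law \<theta> (\<lambda>k. e k \<omega>) n) (survival n))
          \<longlonglongrightarrow> 1"
      using good by eventually_elim (use survival_asymptotics[OF th] in blast)
    show "AE \<omega> in M.
        (\<lambda>n. R_inv (\<lambda>k. e k \<omega>) n powr (- 1 / \<theta>) *
             measure_pmf.expectation (cond_pmf (reversed_law \<theta> (\<lambda>k. e k \<omega>) n) (survival n))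
               (\<lambda>zs. real (zs ! n)))
          \<longlonglongrightarrow> 1"
      using good by eventually_elim (use expectation_asymptotics[OF th] in blast)
    show "AE \<omega> in M.
        weak_conv_m
          (\<lambda>n. distr (measure_pmf (cond_pmf (reversed_law \<theta> (\<lambda>k. e k \<omega>) n) (survival n))) borel
             (\<lambda>zs. real (zs ! n) / R_inv (\<lambda>k. e k \<omega>) n powr (1 / \<theta>)))
          (CPF_plus \<theta> 1)"
      using good by eventually_elim (use weak_limit[OF th] in blast)
  qed
qed

end
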